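(* Let $\mathcal{L}$ be one of $QLP$, $QK3$, or $QCL$. Then $\mathcal{L}$ is sound and complete with respect to the class of all $\mathcal{L}$-structures: for every signature $\mathcal{S}$ and every $\Gamma\cup\{A\}\subseteq Sent(\mathcal{S})$, $\Gamma\vdash_{\mathcal{L}}A$ if and only if, for every $\mathcal{L}$-structure $\mathfrak{A}$ for $\mathcal{S}$, if $v_{\mathfrak{A}}(B)=1$ for every $B\in\Gamma$, then $v_{\mathfrak{A}}(A)=1$.
   Context: **Language of $QFDE$ and its extensions.** A signature is a pair $\mathcal{S}=\langle\mathcal{C},\mathcal{P}\rangle$, where $\mathcal{C}$ is an infinite set of individual constants and $\mathcal{P}$ is a set of predicate letters, each of finite arity, containing a binary identity predicate $\approx$. The logical symbols are $\neg$, $\land,\lor$, $\forall,\exists$, and variables $\mathcal{V}=\{v_i:i\in\mathbb{N}\}$. Terms are variables and constants (no function symbols). Formulas are defined as usual, except that void quantifiers are not allowed: $\forall xB$ and $\exists xB$ are formulas only if $x$ is free in $B$. $Form(\mathcal{S})$ and $Sent(\mathcal{S})$ are the sets of formulas and of sentences (closed formulas). $A(t/x)$ is the result of replacing every free occurrence of $x$ in $A$ by $t$. **Natural deduction system $QFDE$** (over sentences of $\mathcal{S}$; $c,c_1,c_2\in\mathcal{C}$; wherever $A(c/x)$ occurs, $A$ is a formula with no free variable other than $x$; square brackets mark discharged hypotheses): - $\land I$: from $A$, $B$ infer $A\land B$. $\land E$: from $A\land B$ infer $A$; from $A\land B$ infer $B$. - $\lor I$: from $A$ infer $A\lor B$;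 from $B$ infer $A\lor B$. $\lor E$: from $A\lor B$, a derivation of $C$ from $[A]$ and a derivation of $C$ from $[B]$, infer $C$. - $\neg\land I$: from $\neg A$ infer $\neg(A\land B)$; from $\neg B$ infer $\neg(A\land B)$. $\neg\land E$: from $\neg(A\land B)$, a derivation of $C$ from $[\neg A]$ and a derivation of $C$ from $[\neg B]$, infer $C$. - $\neg\lor I$: from $\neg A$, $\neg B$ infer $\neg(A\lor B)$. $\neg\lor E$: from $\neg(A\lor B)$ infer $\neg A$; from $\neg(A\lor B)$ infer $\neg B$. - $DN$: from $A$ infer $\neg\neg A$; from $\neg\neg A$ infer $A$. - $\forall I$: from $B\lor A(c/x)$ infer $B\lor\forall xA$, provided $c$ occurs neither in $A$ or $B$ nor in any hypothesis on which $B\lor A(c/x)$ depends. $\forall E$: from $\forall xA$ infer $A(c/x)$. - $\exists I$: from $A(c/x)$ infer $\exists xA$. $\exists E$: from $\exists xA$ and a derivation of $C$ from $[A(c/x)]$ infer $C$, provided $c$ occurs neither in $A$ or $C$ nor in any hypothesis on which $C$ depends, except $A(c/x)$. - $\neg\forall I$: from $\neg A(c/x)$ infer $\neg\forall xA$. $\neg\forall E$: from $\neg\forall xA$ and a derivation of $C$ from $[\neg A(c/x)]$ infer $C$, provided $c$ occurs neither in $A$ or $C$ nor in any hypothesis on which $C$ depends, except $\neg A(c/x)$. - $\neg\exists I$: from $\neg A(c/x)$ infer $\neg\exists xA$, provided $c$ occurs neither in $A$ nor in any hypothesis on which $\neg A(c/x)$ depends. $\neg\exists E$: from $\neg\exists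 xA$ infer $\neg A(c/x)$. - $\approx I$: infer $c\approx c$ from no premises. $\approx E$: from $c_1\approx c_2$ and $A(c_1/x)$ infer $A(c_2/x)$. **Extensions.** $PEM$: infer $A\lor\neg A$ from no premises. $EXP$: from $A$, $\neg A$ infer $B$. $QLP$ is $QFDE$ plus $PEM$; $QK3$ is $QFDE$ plus $EXP$; $QCL$ is $QFDE$ plus both. $\Gamma\vdash_{\mathcal{L}}A$ means there is a (finite, tree-shaped) derivation of $A$ in $\mathcal{L}$ all of whose undischarged hypotheses belong to $\Gamma$. **Semantics.** A $QFDE$-structure for $\mathcal{S}$ is a pair $\mathfrak{A}=\langle\mathcal{D},\mathcal{I}\rangle$ with $\mathcal{D}\neq\emptyset$ such that $\mathcal{I}(c)=c^{\mathfrak{A}}\in\mathcal{D}$ for each $c\in\mathcal{C}$; each $n$-ary $P\in\mathcal{P}$ is assigned a pair $\langle P_+^{\mathfrak{A}},P_-^{\mathfrak{A}}\rangle$ with $P_+^{\mathfrak{A}}\cup P_-^{\mathfrak{A}}\subseteq\mathcal{D}^n$; and $\approx_+^{\mathfrak{A}}=\{\langle a,a\rangle:a\in\mathcal{D}\}$. It is a $QLP$-structure iff (E1) $P_+^{\mathfrak{A}}\cup P_-^{\mathfrak{A}}=\mathcal{D}^n$ for every $n$ and every $n$-ary $P\in\mathcal{P}$ (including $\approx$); a $QK3$-structure iff (E2) $P_+^{\mathfrak{A}}\cap P_-^{\mathfrak{A}}=\emptyset$ for every $P\in\mathcal{P}$ (including $\approx$); a $QCL$-structure iff both (E1) and (E2)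 hold. The diagram signature $\mathcal{S}_{\mathfrak{A}}=\langle\mathcal{C}_{\mathfrak{A}},\mathcal{P}\rangle$ adds a new constant $\overline{a}$ for each $a\in\mathcal{D}$; $\widehat{\mathfrak{A}}$ is the $\mathcal{S}_{\mathfrak{A}}$-structure that is just like $\mathfrak{A}$ except that $\overline{a}^{\widehat{\mathfrak{A}}}=a$. The valuation induced by $\mathfrak{A}$ is the (unique) map $v_{\mathfrak{A}}:Sent(\mathcal{S}_{\mathfrak{A}})\to\{0,1\}$ such that, writing $v$ for $v_{\mathfrak A}$: - $v(P(c_1,\dots,c_n))=1$ iff $\langle c_1^{\widehat{\mathfrak{A}}},\dots,c_n^{\widehat{\mathfrak{A}}}\rangle\in P_+^{\mathfrak{A}}$, and $v(\neg P(c_1,\dots,c_n))=1$ iff $\langle c_1^{\widehat{\mathfrak{A}}},\dots,c_n^{\widehat{\mathfrak{A}}}\rangle\in P_-^{\mathfrak{A}}$, for all $c_1,\dots,c_n\in\mathcal{C}_{\mathfrak{A}}$; - $v(A\land B)=1$ iff $v(A)=1$ and $v(B)=1$; $v(A\lor B)=1$ iff $v(A)=1$ or $v(B)=1$; - $v(\neg(A\land B))=1$ iff $v(\neg A)=1$ or $v(\neg B)=1$; $v(\neg(A\lor B))=1$ iff $v(\neg A)=1$ and $v(\neg B)=1$; - $v(\neg\neg A)=1$ iff $v(A)=1$; - $v(\forall xA)=1$ iff $v(A(\overline{a}/x))=1$ for every $a\in\mathcal{D}$; $v(\exists xA)=1$ iff $v(A(\overline{a}/x))=1$ for some $a\in\mathcal{D}$;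 - $v(\neg\forall xA)=1$ iff $v(\neg A(\overline{a}/x))=1$ for some $a\in\mathcal{D}$; $v(\neg\exists xA)=1$ iff $v(\neg A(\overline{a}/x))=1$ for every $a\in\mathcal{D}$. *)

theory Defs
  imports Main
begin

section \<open>Syntax\<close>

text \<open>The letters of a signature form sets, not whole types; the arity of a letter outside
  \<open>Preds S\<close> is irrelevant.\<close>

record ('c, 'p) signature =
  Consts :: "'c set"
  Preds  :: "'p set"
  arity  :: "'p \<Rightarrow> nat"
  ident  :: 'p

definition is_signature :: "('c, 'p) signature \<Rightarrow> bool" where
  "is_signature S \<longleftrightarrow>
     infinite (Consts S) \<and> ident S \<in> Preds S \<and> arity S (ident S) = 2"

datatype 'c tm = Var nat | Const 'c

datatype (consts_fm: 'c, preds_fm: 'p) fm =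
    Atom 'p "'c tm list"
  | Neg "('c, 'p) fm"
  | Con "('c, 'p) fm" "('c, 'p) fm"
  | Dis "('c, 'p) fm" "('c, 'p) fm"
  | Forall nat "('c, 'p) fm"
  | Exists nat "('c, 'p) fm"

primrec free_vars :: "('c, 'p) fm \<Rightarrow> nat set" where
  "free_vars (Atom P ts) = {x. Var x \<in> set ts}"
| "free_vars (Neg A) = free_vars A"
| "free_vars (Con A B) = free_vars A \<union> free_vars B"
| "free_vars (Dis A B) = free_vars A \<union> free_vars B"
| "free_vars (Forall x A) = free_vars A - {x}"
| "free_vars (Exists x A) = free_vars A - {x}"

text \<open>The conditions \<open>x \<in> free_vars A\<close> exclude void quantifiers.\<close>

primrec is_form :: "('c, 'p) signature \<Rightarrow> ('c, 'p) fm \<Rightarrow> bool" where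
  "is_form S (Atom P ts) \<longleftrightarrow>
     P \<in> Preds S \<and> length ts = arity S P \<and> (\<forall>c. Const c \<in> set ts \<longrightarrow> c \<in> Consts S)"
| "is_form S (Neg A) \<longleftrightarrow> is_form S A"
| "is_form S (Con A B) \<longleftrightarrow> is_form S A \<and> is_form S B"
| "is_form S (Dis A B) \<longleftrightarrow> is_form S A \<and> is_form S B"
| "is_form S (Forall x A) \<longleftrightarrow> is_form S A \<and> x \<in> free_vars A"
| "is_form S (Exists x A) \<longleftrightarrow> is_form S A \<and> x \<in> free_vars A"

definition Form :: "('c, 'p) signature \<Rightarrow> ('c, 'p) fm set" where
  "Form S = {A. is_form S A}"

definition Sent :: "('c, 'p) signature \<Rightarrow> ('c, 'p) fm set" where
  "Sent S = {A \<in> Form S. free_vars A = {}}"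

text \<open>\<open>subst A c x\<close> is $A(c/x)$. Only constants are ever substituted, so no variable can be
  captured.\<close>

primrec subst :: "('c, 'p) fm \<Rightarrow> 'c \<Rightarrow> nat \<Rightarrow> ('c, 'p) fm" where
  "subst (Atom P ts) c x = Atom P (map (\<lambda>t. if t = Var x then Const c else t) ts)"
| "subst (Neg A) c x = Neg (subst A c x)"
| "subst (Con A B) c x = Con (subst A c x) (subst B c x)"
| "subst (Dis A B) c x = Dis (subst A c x) (subst B c x)"
| "subst (Forall y A) c x = Forall y (if y = x then A else subst A c x)"
| "subst (Exists y A) c x = Exists y (if y = x then A else subst A c x)"

lemma size_subst [simp]: "size (subst A c x) = size A"
proof (induction A)
  case (Atom P ts)
  have "size (if t = Var x then Const c else t) = size t" for t :: "'a tm"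
    by (cases t) auto
  then show ?case by (simp add: size_list_conv_sum_list o_def)
qed auto

abbreviation Eq :: "('c, 'p) signature \<Rightarrow> 'c \<Rightarrow> 'c \<Rightarrow> ('c, 'p) fm" where
  "Eq S c d \<equiv> Atom (ident S) [Const c, Const d]"


section \<open>Natural deduction\<close>

datatype logic = QFDE | QLP | QK3 | QCL

definition has_PEM :: "logic \<Rightarrow> bool" where
  "has_PEM L \<longleftrightarrow> L \<in> {QLP, QCL}"

definition has_EXP :: "logic \<Rightarrow> bool" where
  "has_EXP L \<longleftrightarrow> L \<in> {QK3, QCL}"

text \<open>\<open>deriv L S H A\<close>: there is a finite derivation tree in \<open>L\<close> over sentences of \<open>S\<close> with
  conclusion \<open>A\<close> whose set of undischarged hypotheses is exactly \<open>H\<close>. A rule that discharges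
  \<open>B\<close> removes \<open>B\<close> from the hypotheses of the subderivation concerned; the discharge may be
  vacuous. Membership in \<open>Sent S\<close> is required wherever it does not follow from the premises.\<close>

inductive deriv ::
  "logic \<Rightarrow> ('c, 'p) signature \<Rightarrow> ('c, 'p) fm set \<Rightarrow> ('c, 'p) fm \<Rightarrow> bool"
  for L :: logic and S :: "('c, 'p) signature" where
  Hyp:   "A \<in> Sent S \<Longrightarrow> deriv L S {A} A"
| ConI:  "deriv L S H1 A \<Longrightarrow> deriv L S H2 B \<Longrightarrow> deriv L S (H1 \<union> H2) (Con A B)"
| ConE1: "deriv L S H (Con A B) \<Longrightarrow> deriv L S H A"
| ConE2: "deriv L S H (Con A B) \<Longrightarrow> deriv L S H B"
| DisI1: "deriv L S H A \<Longrightarrow> B \<in> Sent S \<Longrightarrow> deriv L S H (Dis A B)"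
| DisI2: "deriv L S H B \<Longrightarrow> A \<in> Sent S \<Longrightarrow> deriv L S H (Dis A B)"
| DisE:  "deriv L S H (Dis A B) \<Longrightarrow> deriv L S H1 C \<Longrightarrow> deriv L S H2 C \<Longrightarrow>
          deriv L S (H \<union> (H1 - {A}) \<union> (H2 - {B})) C"
| NConI1: "deriv L S H (Neg A) \<Longrightarrow> B \<in> Sent S \<Longrightarrow> deriv L S H (Neg (Con A B))"
| NConI2: "deriv L S H (Neg B) \<Longrightarrow> A \<in> Sent S \<Longrightarrow> deriv L S H (Neg (Con A B))"
| NConE: "deriv L S H (Neg (Con A B)) \<Longrightarrow> deriv L S H1 C \<Longrightarrow> deriv L S H2 C \<Longrightarrow>
          deriv L S (H \<union> (H1 - {Neg A}) \<union> (H2 - {Neg B})) C"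
| NDisI: "deriv L S H1 (Neg A) \<Longrightarrow> deriv L S H2 (Neg B) \<Longrightarrow>
          deriv L S (H1 \<union> H2) (Neg (Dis A B))"
| NDisE1: "deriv L S H (Neg (Dis A B)) \<Longrightarrow> deriv L S H (Neg A)"
| NDisE2: "deriv L S H (Neg (Dis A B)) \<Longrightarrow> deriv L S H (Neg B)"
| DNI:   "deriv L S H A \<Longrightarrow> deriv L S H (Neg (Neg A))"
| DNE:   "deriv L S H (Neg (Neg A)) \<Longrightarrow> deriv L S H A"
| AllI:  "deriv L S H (Dis B (subst A c x)) \<Longrightarrow> Forall x A \<in> Sent S \<Longrightarrow> c \<in> Consts S \<Longrightarrow>
          c \<notin> consts_fm A \<Longrightarrow> c \<notin> consts_fm B \<Longrightarrow> (\<forall>D\<in>H. c \<notin> consts_fm D) \<Longrightarrow>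
          deriv L S H (Dis B (Forall x A))"
| AllE:  "deriv L S H (Forall x A) \<Longrightarrow> c \<in> Consts S \<Longrightarrow> deriv L S H (subst A c x)"
| ExI:   "deriv L S H (subst A c x) \<Longrightarrow> Exists x A \<in> Sent S \<Longrightarrow> c \<in> Consts S \<Longrightarrow>
          deriv L S H (Exists x A)"
| ExE:   "deriv L S H (Exists x A) \<Longrightarrow> deriv L S H1 C \<Longrightarrow> c \<in> Consts S \<Longrightarrow>
          c \<notin> consts_fm A \<Longrightarrow> c \<notin> consts_fm C \<Longrightarrow>
          (\<forall>D \<in> H1 - {subst A c x}. c \<notin> consts_fm D) \<Longrightarrow>
          deriv L S (H \<union> (H1 - {subst A c x})) C"
| NAllI: "deriv L S H (Neg (subst A c x)) \<Longrightarrow> Forall x A \<in> Sent S \<Longrightarrow> c \<in> Consts S \<Longrightarrow>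
          deriv L S H (Neg (Forall x A))"
| NAllE: "deriv L S H (Neg (Forall x A)) \<Longrightarrow> deriv L S H1 C \<Longrightarrow> c \<in> Consts S \<Longrightarrow>
          c \<notin> consts_fm A \<Longrightarrow> c \<notin> consts_fm C \<Longrightarrow>
          (\<forall>D \<in> H1 - {Neg (subst A c x)}. c \<notin> consts_fm D) \<Longrightarrow>
          deriv L S (H \<union> (H1 - {Neg (subst A c x)})) C"
| NExI:  "deriv L S H (Neg (subst A c x)) \<Longrightarrow> Exists x A \<in> Sent S \<Longrightarrow> c \<in> Consts S \<Longrightarrow>
          c \<notin> consts_fm A \<Longrightarrow> (\<forall>D\<in>H. c \<notin> consts_fm D) \<Longrightarrow>
          deriv L S H (Neg (Exists x A))"
| NExE:  "deriv L S H (Neg (Exists x A)) \<Longrightarrow> c \<in> Consts S \<Longrightarrow> deriv L S H (Neg (subst A c x))"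
| EqI:   "c \<in> Consts S \<Longrightarrow> deriv L S {} (Eq S c c)"
| EqE:   "deriv L S H1 (Eq S c1 c2) \<Longrightarrow> deriv L S H2 (subst A c1 x) \<Longrightarrow>
          A \<in> Form S \<Longrightarrow> free_vars A \<subseteq> {x} \<Longrightarrow>
          deriv L S (H1 \<union> H2) (subst A c2 x)"
| PEM:   "has_PEM L \<Longrightarrow> A \<in> Sent S \<Longrightarrow> deriv L S {} (Dis A (Neg A))"
| EXP:   "has_EXP L \<Longrightarrow> deriv L S H1 A \<Longrightarrow> deriv L S H2 (Neg A) \<Longrightarrow> B \<in> Sent S \<Longrightarrow>
          deriv L S (H1 \<union> H2) B"

definition derivable ::
  "logic \<Rightarrow> ('c, 'p) signature \<Rightarrow> ('c, 'p) fm set \<Rightarrow> ('c, 'p) fm \<Rightarrow> bool" where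
  "derivable L S \<Gamma> A \<longleftrightarrow> (\<exists>H \<subseteq> \<Gamma>. deriv L S H A)"


section \<open>Semantics\<close>

record ('c, 'p, 'd) struct =
  Dom  :: "'d set"
  cint :: "'c \<Rightarrow> 'd"
  pos  :: "'p \<Rightarrow> 'd list set"
  neg  :: "'p \<Rightarrow> 'd list set"

definition tuples :: "'d set \<Rightarrow> nat \<Rightarrow> 'd list set" where
  "tuples D n = {as. length as = n \<and> set as \<subseteq> D}"

definition is_QFDE_struct :: "('c, 'p) signature \<Rightarrow> ('c, 'p, 'd) struct \<Rightarrow> bool" where
  "is_QFDE_struct S \<AA> \<longleftrightarrow>
     Dom \<AA> \<noteq> {} \<and>
     (\<forall>c \<in> Consts S. cint \<AA> c \<in> Dom \<AA>) \<and>
     (\<forall>P \<in> Preds S. pos \<AA> P \<union> neg \<AA> P \<subseteq> tuples (Dom \<AA>) (arity S P)) \<and>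
     pos \<AA> (ident S) = {[a, a] | a. a \<in> Dom \<AA>}"

definition E1 :: "('c, 'p) signature \<Rightarrow> ('c, 'p, 'd) struct \<Rightarrow> bool" where
  "E1 S \<AA> \<longleftrightarrow> (\<forall>P \<in> Preds S. pos \<AA> P \<union> neg \<AA> P = tuples (Dom \<AA>) (arity S P))"

definition E2 :: "('c, 'p) signature \<Rightarrow> ('c, 'p, 'd) struct \<Rightarrow> bool" where
  "E2 S \<AA> \<longleftrightarrow> (\<forall>P \<in> Preds S. pos \<AA> P \<inter> neg \<AA> P = {})"

fun is_struct :: "logic \<Rightarrow> ('c, 'p) signature \<Rightarrow> ('c, 'p, 'd) struct \<Rightarrow> bool" where
  "is_struct QFDE S \<AA> \<longleftrightarrow> is_QFDE_struct S \<AA>"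
| "is_struct QLP S \<AA> \<longleftrightarrow> is_QFDE_struct S \<AA> \<and> E1 S \<AA>"
| "is_struct QK3 S \<AA> \<longleftrightarrow> is_QFDE_struct S \<AA> \<and> E2 S \<AA>"
| "is_struct QCL S \<AA> \<longleftrightarrow> is_QFDE_struct S \<AA> \<and> E1 S \<AA> \<and> E2 S \<AA>"

text \<open>In the diagram signature, \<open>Inl c\<close> is the old constant \<open>c\<close> and \<open>Inr a\<close> is the new
  constant naming \<open>a\<close>.\<close>

definition diagram_sig ::
  "('c, 'p) signature \<Rightarrow> ('c, 'p, 'd) struct \<Rightarrow> ('c + 'd, 'p) signature" where
  "diagram_sig S \<AA> = \<lparr>Consts = Inl ` Consts S \<union> Inr ` Dom \<AA>, Preds = Preds S,
                       arity = arity S, ident = ident S\<rparr>"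

definition hat :: "('c, 'p, 'd) struct \<Rightarrow> ('c + 'd, 'p, 'd) struct" where
  "hat \<AA> = \<lparr>Dom = Dom \<AA>, cint = case_sum (cint \<AA>) (\<lambda>a. a), pos = pos \<AA>, neg = neg \<AA>\<rparr>"

abbreviation emb :: "('c, 'p) fm \<Rightarrow> ('c + 'd, 'p) fm" where
  "emb \<equiv> map_fm Inl (\<lambda>P. P)"

text \<open>The value of a variable is arbitrary: it is never used when evaluating sentences.\<close>

primrec tm_val :: "('c, 'p, 'd) struct \<Rightarrow> 'c tm \<Rightarrow> 'd" where
  "tm_val \<AA> (Const c) = cint \<AA> c"
| "tm_val \<AA> (Var x) = undefined"

text \<open>The valuation $v_{\mathfrak A}$ on sentences of the diagram signature, with \<open>True\<close> for the
  value 1.\<close>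

fun val :: "('c, 'p, 'd) struct \<Rightarrow> ('c + 'd, 'p) fm \<Rightarrow> bool" where
  "val \<AA> (Atom P ts) \<longleftrightarrow> map (tm_val (hat \<AA>)) ts \<in> pos \<AA> P"
| "val \<AA> (Neg (Atom P ts)) \<longleftrightarrow> map (tm_val (hat \<AA>)) ts \<in> neg \<AA> P"
| "val \<AA> (Con A B) \<longleftrightarrow> val \<AA> A \<and> val \<AA> B"
| "val \<AA> (Dis A B) \<longleftrightarrow> val \<AA> A \<or> val \<AA> B"
| "val \<AA> (Neg (Con A B)) \<longleftrightarrow> val \<AA> (Neg A) \<or> val \<AA> (Neg B)"
| "val \<AA> (Neg (Dis A B)) \<longleftrightarrow> val \<AA> (Neg A) \<and> val \<AA> (Neg B)"
| "val \<AA> (Neg (Neg A)) \<longleftrightarrow> val \<AA> A"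
| "val \<AA> (Forall x A) \<longleftrightarrow> (\<forall>a \<in> Dom \<AA>. val \<AA> (subst A (Inr a) x))"
| "val \<AA> (Exists x A) \<longleftrightarrow> (\<exists>a \<in> Dom \<AA>. val \<AA> (subst A (Inr a) x))"
| "val \<AA> (Neg (Forall x A)) \<longleftrightarrow> (\<exists>a \<in> Dom \<AA>. val \<AA> (Neg (subst A (Inr a) x)))"
| "val \<AA> (Neg (Exists x A)) \<longleftrightarrow> (\<forall>a \<in> Dom \<AA>. val \<AA> (Neg (subst A (Inr a) x)))"

text \<open>Preservation of truth in all \<open>L\<close>-structures whose domain is a nonempty set of elements
  of type \<open>'d\<close>. Completeness can only hold if \<open>'d\<close> is large enough (it fails for \<open>unit\<close>); an
  injection of \<open>Sent S\<close> into \<open>'d\<close> suffices, and exists for \<open>'d = ('c, 'p) fm\<close>.\<close>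

definition entails ::
  "'d itself \<Rightarrow> logic \<Rightarrow> ('c, 'p) signature \<Rightarrow> ('c, 'p) fm set \<Rightarrow> ('c, 'p) fm \<Rightarrow> bool" where
  "entails (_ :: 'd itself) L S \<Gamma> A \<longleftrightarrow>
     (\<forall>\<AA> :: ('c, 'p, 'd) struct. is_struct L S \<AA> \<longrightarrow>
        (\<forall>B \<in> \<Gamma>. val \<AA> (emb B)) \<longrightarrow> val \<AA> (emb A))"


section \<open>Consistency checks\<close>

lemma free_vars_subst: "free_vars (subst A c x) = free_vars A - {x}"
  by (induction A) auto

lemma is_form_subst: "is_form S A \<Longrightarrow> c \<in> Consts S \<Longrightarrow> is_form S (subst A c x)"
  by (induction A) (auto simp: free_vars_subst)

lemma Sent_iff:
  "Neg A \<in> Sent S \<longleftrightarrow> A \<in> Sent S"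
  "Con A B \<in> Sent S \<longleftrightarrow> A \<in> Sent S \<and> B \<in> Sent S"
  "Dis A B \<in> Sent S \<longleftrightarrow> A \<in> Sent S \<and> B \<in> Sent S"
  by (auto simp: Sent_def Form_def)

lemma Sent_subst:
  "A \<in> Form S \<Longrightarrow> free_vars A \<subseteq> {x} \<Longrightarrow> c \<in> Consts S \<Longrightarrow> subst A c x \<in> Sent S"
  "Forall x A \<in> Sent S \<Longrightarrow> c \<in> Consts S \<Longrightarrow> subst A c x \<in> Sent S"
  "Exists x A \<in> Sent S \<Longrightarrow> c \<in> Consts S \<Longrightarrow> subst A c x \<in> Sent S"
  by (simp_all add: Sent_def Form_def free_vars_subst is_form_subst)

lemma Sent_Eq:
  "is_signature S \<Longrightarrow> Eq S c d \<in> Sent S \<longleftrightarrow> c \<in> Consts S \<and> d \<in> Consts S"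
  by (auto simp: Sent_def Form_def is_signature_def)

lemma deriv_hyps_finite: "deriv L S H A \<Longrightarrow> finite H"
  by (induction rule: deriv.induct) blast+

lemma deriv_hyps_Sent: "deriv L S H A \<Longrightarrow> H \<subseteq> Sent S"
  by (induction rule: deriv.induct) blast+

lemma deriv_Sent:
  assumes "is_signature S" and "deriv L S H A"
  shows "A \<in> Sent S"
  using assms(2)
proof (induction rule: deriv.induct)
  case (EqE H1 c1 c2 H2 A x)
  then have "c2 \<in> Consts S" using Sent_Eq[OF assms(1)] by blast
  then show ?case by (rule Sent_subst(1)[OF EqE.hyps(3,4)])
next
  case (EqI c)
  then show ?case using Sent_Eq[OF assms(1)] by blast
qed (simp_all only: Sent_iff Sent_subst(2,3))

lemma map_tm_eq_iff:
  "Var x = map_tm f t \<longleftrightarrow> t = Var x"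
  "Const d = map_tm f t \<longleftrightarrow> (\<exists>c. d = f c \<and> t = Const c)"
  by (cases t; auto)+

lemma free_vars_emb: "free_vars (emb A) = free_vars A"
  by (induction A) (simp_all add: image_iff map_tm_eq_iff)

lemma is_form_emb: "is_form S A \<Longrightarrow> is_form (diagram_sig S \<AA>) (emb A)"
  by (induction A) (auto simp: diagram_sig_def image_iff map_tm_eq_iff free_vars_emb)

lemma emb_Sent: "A \<in> Sent S \<Longrightarrow> emb A \<in> Sent (diagram_sig S \<AA>)"
  by (simp add: Sent_def Form_def free_vars_emb is_form_emb)

lemma is_struct_hat: "is_struct L S \<AA> \<Longrightarrow> is_struct L (diagram_sig S \<AA>) (hat \<AA>)"
  by (cases L) (auto simp: is_QFDE_struct_def E1_def E2_def diagram_sig_def hat_def)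

end

theory Submission
  imports Defs
begin

text \<open>Completeness is a Henkin argument. The logics have no implication, so a Henkin axiom cannot
  be added as a hypothesis; instead one works with several conclusions at once, and a witnessing
  rule from \<open>P\<close> to \<open>R\<close> allows one to derive \<open>\<Delta>\<close> from \<open>\<Gamma>\<close> whenever \<open>\<Delta>\<close> is derivable
  from \<open>\<Gamma>, R\<close> and \<open>\<Delta>, P\<close> from \<open>\<Gamma>\<close>. Finitely many such rules can be eliminated,
  beginning with the one whose witness is of highest rank: it is fresh for everything else, and
  the eigenconstant rules apply. A set that is maximal among those not deriving \<open>A\<close> is then a
  prime theory with witnesses and counterexamples; its canonical structure, the constants modulo
  \<open>\<approx>\<close>, refutes \<open>A\<close>. By \<open>PEM\<close> and primeness it satisfies (E1), by \<open>EXP\<close> and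
  properness (E2). Since witnesses are indexed by sentences, there are no more of them than
  sentences of the original signature, also when the latter is uncountable.\<close>

section \<open>Soundness\<close>

abbreviation ren :: "('c \<Rightarrow> 'k) \<Rightarrow> ('c, 'p) fm \<Rightarrow> ('k, 'p) fm" where
  "ren g \<equiv> map_fm g (\<lambda>P. P)"

primrec tm_ev :: "('c \<Rightarrow> 'd) \<Rightarrow> (nat \<Rightarrow> 'd) \<Rightarrow> 'c tm \<Rightarrow> 'd" where
  "tm_ev i e (Var x) = e x"
| "tm_ev i e (Const c) = i c"

text \<open>A Tarskian counterpart of \<open>val\<close>: the Boolean argument tells whether the formula or its
  negation is evaluated, and \<open>i\<close> interprets the constants in place of \<open>cint M\<close>.\<close>

primrec ev ::
  "('e, 'p, 'd) struct \<Rightarrow> ('c \<Rightarrow> 'd) \<Rightarrow> bool \<Rightarrow> (nat \<Rightarrow> 'd) \<Rightarrow> ('c, 'p) fm \<Rightarrow> bool" where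
  "ev M i b e (Atom P ts) \<longleftrightarrow> map (tm_ev i e) ts \<in> (if b then pos M P else neg M P)"
| "ev M i b e (Neg A) \<longleftrightarrow> ev M i (\<not> b) e A"
| "ev M i b e (Con A B) \<longleftrightarrow>
     (if b then ev M i b e A \<and> ev M i b e B else ev M i b e A \<or> ev M i b e B)"
| "ev M i b e (Dis A B) \<longleftrightarrow>
     (if b then ev M i b e A \<or> ev M i b e B else ev M i b e A \<and> ev M i b e B)"
| "ev M i b e (Forall x A) \<longleftrightarrow>
     (if b then \<forall>a\<in>Dom M. ev M i b (e(x := a)) A else \<exists>a\<in>Dom M. ev M i b (e(x := a)) A)"
| "ev M i b e (Exists x A) \<longleftrightarrow>
     (if b then \<exists>a\<in>Dom M. ev M i b (e(x := a)) A else \<forall>a\<in>Dom M. ev M i b (e(x := a)) A)"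

section \<open>Invariance and substitution properties of the evaluation with assignments\<close>

lemma tm_ev_cong:
  assumes "\<forall>c\<in>set_tm t. i c = i' c" and "\<forall>x. t = Var x \<longrightarrow> e x = e' x"
  shows "tm_ev i e t = tm_ev i' e' t"
  using assms by (cases t) auto

lemma ev_cong:
  assumes "\<forall>c\<in>consts_fm A. i c = i' c" and "\<forall>x\<in>free_vars A. e x = e' x"
  shows "ev M i b e A = ev M i' b e' A"
  using assms
proof (induction A arbitrary: b e e')
  case (Atom P ts)
  have "map (tm_ev i e) ts = map (tm_ev i' e') ts"
    using Atom by (intro map_cong refl tm_ev_cong) auto
  then show ?case by (simp only: ev.simps)
next
  case (Neg A)
  then show ?case by simp
next
  case (Con A B)
  have "ev M i b e A = ev M i' b e' A" "ev M i b e B = ev M i' b e' B"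
    using Con by auto
  then show ?case by (cases b) simp_all
next
  case (Dis A B)
  have "ev M i b e A = ev M i' b e' A" "ev M i b e B = ev M i' b e' B"
    using Dis by auto
  then show ?case by (cases b) simp_all
next
  case (Forall x A)
  have "ev M i b (e(x := a)) A = ev M i' b (e'(x := a)) A" for a
    using Forall.prems by (intro Forall.IH) auto
  then show ?case by (cases b) simp_all
next
  case (Exists x A)
  have "ev M i b (e(x := a)) A = ev M i' b (e'(x := a)) A" for a
    using Exists.prems by (intro Exists.IH) auto
  then show ?case by (cases b) simp_all
qed

lemma ev_subst: "ev M i b e (subst A c x) = ev M i b (e(x := i c)) A"
proof (induction A arbitrary: b e)
  case (Atom P ts)
  have "tm_ev i e (if t = Var x then Const c else t) = tm_ev i (e(x := i c)) t" for t
    by (cases t) auto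
  then show ?case by (simp add: o_def del: fun_upd_apply)
qed (auto simp: fun_upd_twist)

lemma ev_ren: "ev M i b e (ren g A) = ev M (i \<circ> g) b e A"
proof (induction A arbitrary: b e)
  case (Atom P ts)
  have "tm_ev i e (map_tm g t) = tm_ev (i \<circ> g) e t" for t
    by (cases t) auto
  then show ?case by (simp add: o_def)
qed auto

text \<open>\<open>val\<close> instantiates a quantifier by the names \<open>Inr a\<close>, whereas
  \<open>ev\<close> updates the assignment; \<open>ev_subst\<close> matches the two, since
  \<open>hat\<close> interprets \<open>Inr a\<close> as \<open>a\<close>. The assignment is
  constantly \<open>undefined\<close> because \<open>tm_val\<close> gives variables this
  value.\<close>

lemma val_eq_ev: "val M A = ev M (cint (hat M)) True (\<lambda>_. undefined) A"
proof (induction M A rule: val.induct)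
  have *: "tm_val (hat M) = tm_ev (cint (hat M)) (\<lambda>_. undefined)" for M :: "('a, 'b, 'c) struct"
  proof
    fix t show "tm_val (hat M) t = tm_ev (cint (hat M)) (\<lambda>_. undefined) t"
      by (cases t) auto
  qed
  {
    case (1 M P ts) show ?case by (simp add: *)
  next
    case (2 M P ts) show ?case by (simp add: *)
  }
qed (auto simp: ev_subst hat_def)

lemma val_emb: "val M (emb A) = ev M (cint M) True (\<lambda>_. undefined) A"
proof -
  have "cint (hat M) \<circ> Inl = cint M" by (auto simp: hat_def)
  then show ?thesis by (simp add: val_eq_ev ev_ren)
qed

lemma is_structD:
  assumes "is_struct L S M"
  shows "is_QFDE_struct S M" and "has_PEM L \<Longrightarrow> E1 S M" and "has_EXP L \<Longrightarrow> E2 S M"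
  using assms by (cases L; simp add: has_PEM_def has_EXP_def)+

text \<open>(E1) is passed on from atoms to compound formulas because the clauses for the two
  Boolean values are dual. The interpretation and the assignment must stay within the domain, as
  (E1) speaks only of tuples over it.\<close>

lemma ev_total:
  assumes "E1 S M" and "is_form S A"
    and "\<forall>c\<in>Consts S. i c \<in> Dom M" and "\<forall>x. e x \<in> Dom M"
  shows "ev M i True e A \<or> ev M i False e A"
  using assms(2,4)
proof (induction A arbitrary: e)
  case (Atom P ts)
  have "tm_ev i e t \<in> Dom M" if "t \<in> set ts" for t
    using Atom that assms(3) by (cases t) auto
  then have "map (tm_ev i e) ts \<in> tuples (Dom M) (arity S P)"
    using Atom by (auto simp: tuples_def)
  then show ?case using assms(1) Atom by (auto simp: E1_def)
next
  case (Forall x A)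
  have "ev M i True (e(x := a)) A \<or> ev M i False (e(x := a)) A" if "a \<in> Dom M" for a
    using Forall.prems that by (intro Forall.IH) auto
  then show ?case by auto
next
  case (Exists x A)
  have "ev M i True (e(x := a)) A \<or> ev M i False (e(x := a)) A" if "a \<in> Dom M" for a
    using Exists.prems that by (intro Exists.IH) auto
  then show ?case by auto
qed auto

lemma ev_consistent:
  assumes "E2 S M" and "is_form S A"
  shows "\<not> (ev M i True e A \<and> ev M i False e A)"
  using assms(2)
proof (induction A arbitrary: e)
  case (Atom P ts)
  then show ?case using assms(1) by (auto simp: E2_def)
next
  case (Forall x A)
  then show ?case by (simp; blast)
next
  case (Exists x A)
  then show ?case by (simp; blast)
qed auto

lemma ev_upd_fresh: "c \<notin> consts_fm A \<Longrightarrow> ev M (i(c := a)) b e A = ev M i b e A"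
  by (rule ev_cong) auto

text \<open>Reading a fresh constant as \<open>a\<close> amounts to assigning \<open>a\<close> to
  the variable; this validates the eigenconstant rules.\<close>

lemma ev_upd_subst:
  "c \<notin> consts_fm A \<Longrightarrow> ev M (i(c := a)) b e (subst A c x) = ev M i b (e(x := a)) A"
  by (simp add: ev_subst ev_upd_fresh)

text \<open>The interpretation \<open>i\<close> of the constants is separated from \<open>M\<close>
  and generalised in the induction. At an eigenconstant rule the induction hypothesis is thus
  available with the eigenconstant reinterpreted as any element of the domain, and freshness keeps
  the other hypotheses true.\<close>

lemma deriv_sound:
  assumes "deriv L S H A" and S: "is_signature S" and M: "is_struct L S M"
    and "\<forall>c\<in>Consts S. i c \<in> Dom M" and e: "\<forall>x. e x \<in> Dom M"
    and "\<forall>B\<in>H. ev M i True e B"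
  shows "ev M i True e A"
  using assms(1,4,6)
proof (induction arbitrary: i rule: deriv.induct)
  case (DisE H A B H1 C H2)
  then show ?case by (metis DiffI Un_iff empty_iff ev.simps(4) insert_iff)
next
  case (NConE H A B H1 C H2)
  have "ev M i False e A \<or> ev M i False e B"
    using NConE.IH(1)[of i] NConE.prems by simp
  then show ?case
  proof
    assume "ev M i False e A"
    then have "\<forall>D\<in>H1. ev M i True e D" using NConE.prems by auto
    then show ?thesis using NConE by blast
  next
    assume "ev M i False e B"
    then have "\<forall>D\<in>H2. ev M i True e D" using NConE.prems by auto
    then show ?thesis using NConE by blast
  qed
next
  case (AllI H B A c x)
  show ?case
  proof (cases "ev M i True e B")
    \<comment> \<open>If the side disjunct \<open>B\<close> fails, it still fails after
      \<open>c\<close> is reinterpreted, as \<open>c\<close> does not occur in it. The other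
      disjunct must then hold for every value \<open>a\<close> of \<open>c\<close>.\<close>
    case False
    have "ev M i True (e(x := a)) A" if "a \<in> Dom M" for a
    proof -
      have "\<forall>D\<in>H. ev M (i(c := a)) True e D"
        using AllI.hyps AllI.prems by (simp add: ev_upd_fresh)
      moreover have "\<forall>k\<in>Consts S. (i(c := a)) k \<in> Dom M"
        using AllI.prems that by simp
      ultimately have "ev M (i(c := a)) True e (Dis B (subst A c x))"
        by (intro AllI.IH)
      then show ?thesis using AllI.hyps False by (simp add: ev_upd_fresh ev_upd_subst)
    qed
    then show ?thesis by simp
  qed simp
next
  case (AllE H x A c)
  then show ?case by (simp add: ev_subst)
next
  case (ExI H A c x)
  then show ?case by (auto simp: ev_subst)
next
  case (ExE H x A H1 C c)
  have "ev M i True e (Exists x A)" using ExE.prems by (intro ExE.IH(1)) auto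
  then obtain a where a: "a \<in> Dom M" "ev M i True (e(x := a)) A" by auto
  \<comment> \<open>The eigenconstant is made to name the witness \<open>a\<close>: the discharged
    hypothesis becomes true by the choice of \<open>a\<close>, and the others do not contain
    \<open>c\<close>.\<close>
  have "ev M (i(c := a)) True e C"
  proof (rule ExE.IH(2))
    show "\<forall>B\<in>H1. ev M (i(c := a)) True e B"
    proof
      fix D assume "D \<in> H1"
      then show "ev M (i(c := a)) True e D"
        using ExE.hyps ExE.prems a
        by (cases "D = subst A c x") (simp_all add: ev_upd_fresh ev_upd_subst)
    qed
  qed (use ExE.prems a in auto)
  then show ?case using ExE.hyps by (simp add: ev_upd_fresh)
next
  case (NAllI H A c x)
  then show ?case by (auto simp: ev_subst)
next
  case (NAllE H x A H1 C c)
  have "ev M i True e (Neg (Forall x A))" using NAllE.prems by (intro NAllE.IH(1)) auto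
  then obtain a where a: "a \<in> Dom M" "ev M i False (e(x := a)) A" by auto
  have "ev M (i(c := a)) True e C"
  proof (rule NAllE.IH(2))
    show "\<forall>B\<in>H1. ev M (i(c := a)) True e B"
    proof
      fix D assume "D \<in> H1"
      then show "ev M (i(c := a)) True e D"
        using NAllE.hyps NAllE.prems a
        by (cases "D = Neg (subst A c x)") (simp_all add: ev_upd_fresh ev_upd_subst)
    qed
  qed (use NAllE.prems a in auto)
  then show ?case using NAllE.hyps by (simp add: ev_upd_fresh)
next
  case (NExI H A c x)
  have "ev M i False (e(x := a)) A" if "a \<in> Dom M" for a
  proof -
    have "\<forall>D\<in>H. ev M (i(c := a)) True e D"
      using NExI.hyps NExI.prems by (simp add: ev_upd_fresh)
    moreover have "\<forall>k\<in>Consts S. (i(c := a)) k \<in> Dom M"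
      using NExI.prems that by simp
    ultimately have "ev M (i(c := a)) True e (Neg (subst A c x))"
      by (intro NExI.IH)
    then show ?thesis using NExI.hyps by (simp add: ev_upd_subst)
  qed
  then show ?case by simp
next
  case (NExE H x A c)
  then show ?case by (simp add: ev_subst)
next
  case (EqI c)
  then show ?case using is_structD(1)[OF M] by (auto simp: is_QFDE_struct_def)
next
  case (EqE H1 c1 c2 H2 A x)
  have "ev M i True e (Eq S c1 c2)" using EqE by blast
  then have "i c1 = i c2" using is_structD(1)[OF M] by (auto simp: is_QFDE_struct_def)
  moreover have "ev M i True e (subst A c1 x)" using EqE by blast
  ultimately show ?case by (simp add: ev_subst)
next
  case (PEM A)
  then show ?case
    using ev_total[OF is_structD(2)[OF M], of A i e] e by (auto simp: Sent_def Form_def)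
next
  case (EXP H1 A H2 B)
  have "A \<in> Sent S" using deriv_Sent[OF S] EXP by blast
  moreover have "ev M i True e A" "ev M i False e A"
    using EXP.IH(1)[of i] EXP.IH(2)[of i] EXP.prems by auto
  ultimately show ?case
    using ev_consistent[OF is_structD(3)[OF M], of A i e] EXP by (auto simp: Sent_def Form_def)
qed auto

lemma derivable_sound:
  fixes S :: "('c, 'p) signature"
  assumes S: "is_signature S" and "derivable L S \<Gamma> A"
  shows "entails TYPE('d) L S \<Gamma> A"
  unfolding entails_def
proof (intro allI impI)
  fix M :: "('c, 'p, 'd) struct"
  assume M: "is_struct L S M" and G: "\<forall>B\<in>\<Gamma>. val M (emb B)"
  obtain H where H: "H \<subseteq> \<Gamma>" "deriv L S H A" using assms(2) by (auto simp: derivable_def)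
  obtain a where a: "a \<in> Dom M" and i: "\<forall>c\<in>Consts S. cint M c \<in> Dom M"
    using is_structD(1)[OF M] by (auto simp: is_QFDE_struct_def)
  \<comment> \<open>\<open>undefined\<close> may lie outside the domain, so the assignment is
    replaced by one with a value in it; sentences do not notice the change.\<close>
  have *: "ev M (cint M) True (\<lambda>_. a) B = val M (emb B)" if "B \<in> Sent S" for B
    unfolding val_emb using that by (intro ev_cong) (auto simp: Sent_def)
  have "ev M (cint M) True (\<lambda>_. a) A"
    using H G * deriv_hyps_Sent[OF H(2)] a i by (intro deriv_sound[OF H(2) S M]) auto
  then show "val M (emb A)" using * deriv_Sent[OF S H(2)] by simp
qed

section \<open>Derivability\<close>

lemma derivableI: "deriv L S H A \<Longrightarrow> H \<subseteq> \<Gamma> \<Longrightarrow> derivable L S \<Gamma> A"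
  by (auto simp: derivable_def)

lemma derivableE:
  assumes "derivable L S \<Gamma> A"
  obtains H where "H \<subseteq> \<Gamma>" "deriv L S H A"
  using assms by (auto simp: derivable_def)

lemma derivable_mono: "derivable L S \<Gamma> A \<Longrightarrow> \<Gamma> \<subseteq> \<Delta> \<Longrightarrow> derivable L S \<Delta> A"
  unfolding derivable_def by blast

lemma derivable_Sent: "is_signature S \<Longrightarrow> derivable L S \<Gamma> A \<Longrightarrow> A \<in> Sent S"
  by (auto simp: derivable_def dest: deriv_Sent)

lemma derivable_finite:
  assumes "derivable L S \<Gamma> A"
  obtains \<Gamma>\<^sub>0 where "\<Gamma>\<^sub>0 \<subseteq> \<Gamma>" "finite \<Gamma>\<^sub>0" "derivable L S \<Gamma>\<^sub>0 A"
proof -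
  obtain H where "H \<subseteq> \<Gamma>" "deriv L S H A" using assms by (rule derivableE)
  then show ?thesis using that[of H] by (simp add: derivableI deriv_hyps_finite)
qed

lemma derivable_Hyp: "A \<in> \<Gamma> \<Longrightarrow> A \<in> Sent S \<Longrightarrow> derivable L S \<Gamma> A"
  by (rule derivableI[OF deriv.Hyp]) auto

lemma derivable_ConI:
  "derivable L S \<Gamma> A \<Longrightarrow> derivable L S \<Gamma> B \<Longrightarrow> derivable L S \<Gamma> (Con A B)"
  by (elim derivableE, rule derivableI[OF deriv.ConI]) (assumption | rule Un_least)+

lemma derivable_ConE:
  "derivable L S \<Gamma> (Con A B) \<Longrightarrow> derivable L S \<Gamma> A"
  "derivable L S \<Gamma> (Con A B) \<Longrightarrow> derivable L S \<Gamma> B"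
  by (elim derivableE, rule derivableI[OF deriv.ConE1], assumption+)
    (elim derivableE, rule derivableI[OF deriv.ConE2], assumption+)

lemma derivable_DisI:
  "derivable L S \<Gamma> A \<Longrightarrow> B \<in> Sent S \<Longrightarrow> derivable L S \<Gamma> (Dis A B)"
  "derivable L S \<Gamma> B \<Longrightarrow> A \<in> Sent S \<Longrightarrow> derivable L S \<Gamma> (Dis A B)"
  by (elim derivableE, rule derivableI[OF deriv.DisI1], assumption+)
    (elim derivableE, rule derivableI[OF deriv.DisI2], assumption+)

lemma derivable_DisE:
  assumes "derivable L S \<Gamma> (Dis A B)"
    and "derivable L S (insert A \<Gamma>) C" and "derivable L S (insert B \<Gamma>) C"
  shows "derivable L S \<Gamma> C"
proof -
  obtain H H1 H2 where H: "H \<subseteq> \<Gamma>" "H1 \<subseteq> insert A \<Gamma>" "H2 \<subseteq> insert B \<Gamma>"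
    and d: "deriv L S H (Dis A B)" "deriv L S H1 C" "deriv L S H2 C"
    using assms by (elim derivableE) blast
  have "H \<union> (H1 - {A}) \<union> (H2 - {B}) \<subseteq> \<Gamma>" using H by blast
  then show ?thesis by (intro derivableI[OF deriv.DisE[OF d]])
qed

lemma derivable_NConI:
  "derivable L S \<Gamma> (Neg A) \<Longrightarrow> B \<in> Sent S \<Longrightarrow> derivable L S \<Gamma> (Neg (Con A B))"
  "derivable L S \<Gamma> (Neg B) \<Longrightarrow> A \<in> Sent S \<Longrightarrow> derivable L S \<Gamma> (Neg (Con A B))"
  by (elim derivableE, rule derivableI[OF deriv.NConI1], assumption+)
    (elim derivableE, rule derivableI[OF deriv.NConI2], assumption+)

lemma derivable_NConE:
  assumes "derivable L S \<Gamma> (Neg (Con A B))"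
    and "derivable L S (insert (Neg A) \<Gamma>) C" and "derivable L S (insert (Neg B) \<Gamma>) C"
  shows "derivable L S \<Gamma> C"
proof -
  obtain H H1 H2 where H: "H \<subseteq> \<Gamma>" "H1 \<subseteq> insert (Neg A) \<Gamma>" "H2 \<subseteq> insert (Neg B) \<Gamma>"
    and d: "deriv L S H (Neg (Con A B))" "deriv L S H1 C" "deriv L S H2 C"
    using assms by (elim derivableE) blast
  have "H \<union> (H1 - {Neg A}) \<union> (H2 - {Neg B}) \<subseteq> \<Gamma>" using H by blast
  then show ?thesis by (intro derivableI[OF deriv.NConE[OF d]])
qed

lemma derivable_NDisI:
  "derivable L S \<Gamma> (Neg A) \<Longrightarrow> derivable L S \<Gamma> (Neg B) \<Longrightarrow> derivable L S \<Gamma> (Neg (Dis A B))"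
  by (elim derivableE, rule derivableI[OF deriv.NDisI]) (assumption | rule Un_least)+

lemma derivable_NDisE:
  "derivable L S \<Gamma> (Neg (Dis A B)) \<Longrightarrow> derivable L S \<Gamma> (Neg A)"
  "derivable L S \<Gamma> (Neg (Dis A B)) \<Longrightarrow> derivable L S \<Gamma> (Neg B)"
  by (elim derivableE, rule derivableI[OF deriv.NDisE1], assumption+)
    (elim derivableE, rule derivableI[OF deriv.NDisE2], assumption+)

lemma derivable_DNI: "derivable L S \<Gamma> A \<Longrightarrow> derivable L S \<Gamma> (Neg (Neg A))"
  by (elim derivableE, rule derivableI[OF deriv.DNI])

lemma derivable_DNE: "derivable L S \<Gamma> (Neg (Neg A)) \<Longrightarrow> derivable L S \<Gamma> A"
  by (elim derivableE, rule derivableI[OF deriv.DNE])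

lemma derivable_AllI:
  "derivable L S \<Gamma> (Dis B (subst A c x)) \<Longrightarrow> Forall x A \<in> Sent S \<Longrightarrow> c \<in> Consts S \<Longrightarrow>
   c \<notin> consts_fm A \<Longrightarrow> c \<notin> consts_fm B \<Longrightarrow> \<forall>D\<in>\<Gamma>. c \<notin> consts_fm D \<Longrightarrow>
   derivable L S \<Gamma> (Dis B (Forall x A))"
  by (elim derivableE, rule derivableI[OF deriv.AllI]) auto

lemma derivable_AllE:
  "derivable L S \<Gamma> (Forall x A) \<Longrightarrow> c \<in> Consts S \<Longrightarrow> derivable L S \<Gamma> (subst A c x)"
  by (elim derivableE, rule derivableI[OF deriv.AllE])

lemma derivable_ExI:
  "derivable L S \<Gamma> (subst A c x) \<Longrightarrow> Exists x A \<in> Sent S \<Longrightarrow> c \<in> Consts S \<Longrightarrow>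
   derivable L S \<Gamma> (Exists x A)"
  by (elim derivableE, rule derivableI[OF deriv.ExI])

lemma derivable_ExE:
  assumes "derivable L S \<Gamma> (Exists x A)" and "derivable L S (insert (subst A c x) \<Gamma>) C"
    and c: "c \<in> Consts S" "c \<notin> consts_fm A" "c \<notin> consts_fm C" "\<forall>D\<in>\<Gamma>. c \<notin> consts_fm D"
  shows "derivable L S \<Gamma> C"
proof -
  obtain H H1 where H: "H \<subseteq> \<Gamma>" "H1 \<subseteq> insert (subst A c x) \<Gamma>"
    and d: "deriv L S H (Exists x A)" "deriv L S H1 C"
    using assms(1,2) by (elim derivableE) blast
  have "H \<union> (H1 - {subst A c x}) \<subseteq> \<Gamma>" "\<forall>D\<in>H1 - {subst A c x}. c \<notin> consts_fm D"
    using H c by auto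
  then show ?thesis by (intro derivableI[OF deriv.ExE[OF d c(1-3)]])
qed

lemma derivable_NAllI:
  "derivable L S \<Gamma> (Neg (subst A c x)) \<Longrightarrow> Forall x A \<in> Sent S \<Longrightarrow> c \<in> Consts S \<Longrightarrow>
   derivable L S \<Gamma> (Neg (Forall x A))"
  by (elim derivableE, rule derivableI[OF deriv.NAllI])

lemma derivable_NAllE:
  assumes "derivable L S \<Gamma> (Neg (Forall x A))"
    and "derivable L S (insert (Neg (subst A c x)) \<Gamma>) C"
    and c: "c \<in> Consts S" "c \<notin> consts_fm A" "c \<notin> consts_fm C" "\<forall>D\<in>\<Gamma>. c \<notin> consts_fm D"
  shows "derivable L S \<Gamma> C"
proof -
  obtain H H1 where H: "H \<subseteq> \<Gamma>" "H1 \<subseteq> insert (Neg (subst A c x)) \<Gamma>"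
    and d: "deriv L S H (Neg (Forall x A))" "deriv L S H1 C"
    using assms(1,2) by (elim derivableE) blast
  have "H \<union> (H1 - {Neg (subst A c x)}) \<subseteq> \<Gamma>"
    "\<forall>D\<in>H1 - {Neg (subst A c x)}. c \<notin> consts_fm D"
    using H c by auto
  then show ?thesis by (intro derivableI[OF deriv.NAllE[OF d c(1-3)]])
qed

lemma derivable_NExI:
  "derivable L S \<Gamma> (Neg (subst A c x)) \<Longrightarrow> Exists x A \<in> Sent S \<Longrightarrow> c \<in> Consts S \<Longrightarrow>
   c \<notin> consts_fm A \<Longrightarrow> \<forall>D\<in>\<Gamma>. c \<notin> consts_fm D \<Longrightarrow>
   derivable L S \<Gamma> (Neg (Exists x A))"
  by (elim derivableE, rule derivableI[OF deriv.NExI]) auto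

lemma derivable_NExE:
  "derivable L S \<Gamma> (Neg (Exists x A)) \<Longrightarrow> c \<in> Consts S \<Longrightarrow>
   derivable L S \<Gamma> (Neg (subst A c x))"
  by (elim derivableE, rule derivableI[OF deriv.NExE])

lemma derivable_EqI: "c \<in> Consts S \<Longrightarrow> derivable L S \<Gamma> (Eq S c c)"
  by (rule derivableI[OF deriv.EqI]) auto

lemma derivable_EqE:
  "derivable L S \<Gamma> (Eq S c1 c2) \<Longrightarrow> derivable L S \<Gamma> (subst A c1 x) \<Longrightarrow>
   A \<in> Form S \<Longrightarrow> free_vars A \<subseteq> {x} \<Longrightarrow> derivable L S \<Gamma> (subst A c2 x)"
  by (elim derivableE, rule derivableI[OF deriv.EqE]) (assumption | rule Un_least)+

lemma derivable_PEM: "has_PEM L \<Longrightarrow> A \<in> Sent S \<Longrightarrow> derivable L S \<Gamma> (Dis A (Neg A))"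
  by (rule derivableI[OF deriv.PEM]) auto

lemma derivable_EXP:
  "has_EXP L \<Longrightarrow> derivable L S \<Gamma> A \<Longrightarrow> derivable L S \<Gamma> (Neg A) \<Longrightarrow> B \<in> Sent S \<Longrightarrow>
   derivable L S \<Gamma> B"
  by (elim derivableE, rule derivableI[OF deriv.EXP]) (assumption | rule Un_least)+

text \<open>In place of an implication, disjunction serves: infer \<open>Dis A A\<close> from
  \<open>A\<close> and eliminate it with the same derivation of \<open>C\<close> in both
  cases.\<close>

lemma derivable_cut:
  assumes "is_signature S" and "derivable L S \<Gamma> A" and "derivable L S (insert A \<Gamma>) C"
  shows "derivable L S \<Gamma> C"
  using derivable_DisE[OF derivable_DisI(1)[OF assms(2) derivable_Sent[OF assms(1,2)]] assms(3,3)] .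


section \<open>Renaming constants\<close>

lemma finite_consts_fm: "finite (consts_fm A)"
proof (induction A)
  case (Atom P ts)
  have "finite (set_tm t)" for t :: "'a tm" by (cases t) auto
  then show ?case by simp
qed auto

lemma consts_fm_subst: "consts_fm (subst A c x) \<subseteq> insert c (consts_fm A)"
  by (induction A) (auto split: if_splits)

lemma fresh_const:
  assumes "is_signature S" and "finite H"
  obtains c where "c \<in> Consts S" "\<forall>D\<in>H. c \<notin> consts_fm D"
proof -
  have "finite (\<Union>D\<in>H. consts_fm D)" using assms(2) finite_consts_fm by blast
  moreover have "infinite (Consts S)" using assms(1) by (simp add: is_signature_def)
  ultimately show ?thesis using that by (meson UN_I finite_subset subsetI)
qed

lemma ren_subst: "ren g (subst A c x) = subst (ren g A) (g c) x"
proof (induction A)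
  case (Atom P ts)
  have "map_tm g (if t = Var x then Const c else t)
      = (if map_tm g t = Var x then Const (g c) else map_tm g t)" for t
    by (cases t) auto
  then show ?case by simp
qed auto

lemma free_vars_ren: "free_vars (ren g A) = free_vars A"
  by (induction A) (simp_all add: image_iff map_tm_eq_iff)

lemma ren_upd_fresh: "c \<notin> consts_fm A \<Longrightarrow> ren (g(c := d)) A = ren g A"
  by (rule fm.map_cong0) auto

definition sig_hom :: "('c \<Rightarrow> 'k) \<Rightarrow> ('c, 'p) signature \<Rightarrow> ('k, 'p) signature \<Rightarrow> bool" where
  "sig_hom g S T \<longleftrightarrow> g ` Consts S \<subseteq> Consts T \<and> Preds T = Preds S \<and> arity T = arity S \<and>
     ident T = ident S"

lemma sig_hom_upd: "sig_hom g S T \<Longrightarrow> d \<in> Consts T \<Longrightarrow> sig_hom (g(c := d)) S T"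
  by (auto simp: sig_hom_def)

lemma is_form_ren:
  assumes "sig_hom g S T" and "is_form S A"
  shows "is_form T (ren g A)"
  using assms(2)
proof (induction A)
  case (Atom P ts)
  then show ?case using assms(1) by (auto simp: sig_hom_def image_iff map_tm_eq_iff)
qed (auto simp: free_vars_ren)

lemma Form_ren: "sig_hom g S T \<Longrightarrow> A \<in> Form S \<Longrightarrow> ren g A \<in> Form T"
  by (simp add: Form_def is_form_ren)

lemma Sent_ren: "sig_hom g S T \<Longrightarrow> A \<in> Sent S \<Longrightarrow> ren g A \<in> Sent T"
  by (simp add: Sent_def Form_ren free_vars_ren)

text \<open>A renaming may merge \<open>A\<close> with another hypothesis, so discharging does not
  commute with taking images. Inserting the image of \<open>A\<close> explicitly avoids
  this.\<close>

lemma derivable_ren_discharge: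
  assumes "derivable L T (ren g ` H) D" and "H - {A} \<subseteq> H'"
  shows "derivable L T (insert (ren g A) (ren g ` H')) D"
  by (rule derivable_mono[OF assms(1)]) (use assms(2) in auto)

text \<open>The renaming need not be injective: an eigenconstant is first sent to a constant of \<open>T\<close>
  that is fresh for the images of the finitely many formulas concerned.\<close>

lemma deriv_ren:
  assumes T: "is_signature T" and "deriv L S H A" and "sig_hom g S T"
  shows "derivable L T (ren g ` H) (ren g A)"
  using assms(2,3)
proof (induction arbitrary: g rule: deriv.induct)
  case (Hyp A)
  then show ?case by (simp add: derivable_Hyp Sent_ren)
next
  case (ConI H1 A H2 B)
  show ?case
    using derivable_mono[OF ConI.IH(1)[OF ConI.prems], of "ren g ` (H1 \<union> H2)"]
      derivable_mono[OF ConI.IH(2)[OF ConI.prems], of "ren g ` (H1 \<union> H2)"]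
    by (auto simp: image_Un intro!: derivable_ConI)
next
  case (DisE H A B H1 C H2)
  let ?G = "ren g ` (H \<union> (H1 - {A}) \<union> (H2 - {B}))"
  have "derivable L T ?G (Dis (ren g A) (ren g B))"
    using derivable_mono[OF DisE.IH(1)[OF DisE.prems], of ?G] by auto
  moreover have "derivable L T (insert (ren g A) ?G) (ren g C)"
    using DisE.IH(2)[OF DisE.prems] by (rule derivable_ren_discharge) auto
  moreover have "derivable L T (insert (ren g B) ?G) (ren g C)"
    using DisE.IH(3)[OF DisE.prems] by (rule derivable_ren_discharge) auto
  ultimately show ?case by (rule derivable_DisE)
next
  case (NConE H A B H1 C H2)
  let ?G = "ren g ` (H \<union> (H1 - {Neg A}) \<union> (H2 - {Neg B}))"
  have "derivable L T ?G (Neg (Con (ren g A) (ren g B)))"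
    using derivable_mono[OF NConE.IH(1)[OF NConE.prems], of ?G] by auto
  moreover have "derivable L T (insert (ren g (Neg A)) ?G) (ren g C)"
    using NConE.IH(2)[OF NConE.prems] by (rule derivable_ren_discharge) auto
  moreover have "derivable L T (insert (ren g (Neg B)) ?G) (ren g C)"
    using NConE.IH(3)[OF NConE.prems] by (rule derivable_ren_discharge) auto
  ultimately show ?case using derivable_NConE by fastforce
next
  case (NDisI H1 A H2 B)
  show ?case
    using derivable_mono[OF NDisI.IH(1)[OF NDisI.prems], of "ren g ` (H1 \<union> H2)"]
      derivable_mono[OF NDisI.IH(2)[OF NDisI.prems], of "ren g ` (H1 \<union> H2)"]
    by (auto simp: image_Un intro!: derivable_NDisI)
next
  case (AllI H B A c x)
  have "finite (insert (ren g A) (insert (ren g B) (ren g ` H)))"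
    using AllI.hyps(1) deriv_hyps_finite by blast
  then obtain d where d: "d \<in> Consts T"
    "\<forall>D\<in>insert (ren g A) (insert (ren g B) (ren g ` H)). d \<notin> consts_fm D"
    using fresh_const[OF T] by blast
  let ?g = "g(c := d)"
  \<comment> \<open>Redirecting the eigenconstant \<open>c\<close> to \<open>d\<close> does not
    affect the hypotheses, in which \<open>c\<close> does not occur.\<close>
  have "ren ?g ` H = ren g ` H" using AllI.hyps by (intro image_cong) (auto simp: ren_upd_fresh)
  moreover have "derivable L T (ren ?g ` H) (ren ?g (Dis B (subst A c x)))"
    using AllI.IH[OF sig_hom_upd[OF AllI.prems d(1)]] .
  ultimately have "derivable L T (ren g ` H) (Dis (ren g B) (subst (ren g A) d x))"
    using AllI.hyps by (simp add: ren_subst ren_upd_fresh)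
  moreover have "Forall x (ren g A) \<in> Sent T" using Sent_ren[OF AllI.prems AllI.hyps(2)] by simp
  ultimately have "derivable L T (ren g ` H) (Dis (ren g B) (Forall x (ren g A)))"
    using d by (intro derivable_AllI) auto
  then show ?case by simp
next
  case (AllE H x A c)
  then show ?case by (auto simp: ren_subst sig_hom_def intro!: derivable_AllE)
next
  case (ExI H A c x)
  have "Exists x (ren g A) \<in> Sent T" using Sent_ren[OF ExI.prems ExI.hyps(2)] by simp
  then show ?case using ExI by (auto simp: ren_subst sig_hom_def intro!: derivable_ExI)
next
  case (ExE H x A H1 C c)
  let ?H = "H \<union> (H1 - {subst A c x})"
  have "finite (insert (ren g A) (insert (ren g C) (ren g ` ?H)))"
    using ExE.hyps(1,2) deriv_hyps_finite by blast
  then obtain d where d: "d \<in> Consts T"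
    "\<forall>D\<in>insert (ren g A) (insert (ren g C) (ren g ` ?H)). d \<notin> consts_fm D"
    using fresh_const[OF T] by blast
  let ?g = "g(c := d)"
  have eq: "ren ?g ` (H1 - {subst A c x}) = ren g ` (H1 - {subst A c x})"
    using ExE.hyps by (intro image_cong) (auto simp: ren_upd_fresh)
  have "derivable L T (ren ?g ` H1) (ren g C)"
    using ExE.IH(2)[OF sig_hom_upd[OF ExE.prems d(1), of c]]
    unfolding ren_upd_fresh[OF ExE.hyps(5)] .
  then have "derivable L T
      (insert (ren ?g (subst A c x)) (ren ?g ` (H1 - {subst A c x}))) (ren g C)"
    by (rule derivable_ren_discharge) auto
  then have "derivable L T
      (insert (subst (ren g A) d x) (ren g ` (H1 - {subst A c x}))) (ren g C)"
    unfolding eq using ExE.hyps by (simp add: ren_subst ren_upd_fresh)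
  then have "derivable L T (insert (subst (ren g A) d x) (ren g ` ?H)) (ren g C)"
    by (rule derivable_mono) auto
  moreover have "derivable L T (ren g ` ?H) (Exists x (ren g A))"
    using derivable_mono[OF ExE.IH(1)[OF ExE.prems], of "ren g ` ?H"] by auto
  ultimately show ?case using d by - (rule derivable_ExE[of L T _ x "ren g A" d], auto)
next
  case (NAllI H A c x)
  have "Forall x (ren g A) \<in> Sent T" using Sent_ren[OF NAllI.prems NAllI.hyps(2)] by simp
  then show ?case using NAllI by (auto simp: ren_subst sig_hom_def intro!: derivable_NAllI)
next
  case (NAllE H x A H1 C c)
  let ?H = "H \<union> (H1 - {Neg (subst A c x)})"
  have "finite (insert (ren g A) (insert (ren g C) (ren g ` ?H)))"
    using NAllE.hyps(1,2) deriv_hyps_finite by blast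
  then obtain d where d: "d \<in> Consts T"
    "\<forall>D\<in>insert (ren g A) (insert (ren g C) (ren g ` ?H)). d \<notin> consts_fm D"
    using fresh_const[OF T] by blast
  let ?g = "g(c := d)"
  have eq: "ren ?g ` (H1 - {Neg (subst A c x)}) = ren g ` (H1 - {Neg (subst A c x)})"
    using NAllE.hyps by (intro image_cong) (auto simp: ren_upd_fresh)
  have "derivable L T (ren ?g ` H1) (ren g C)"
    using NAllE.IH(2)[OF sig_hom_upd[OF NAllE.prems d(1), of c]]
    unfolding ren_upd_fresh[OF NAllE.hyps(5)] .
  then have "derivable L T
      (insert (ren ?g (Neg (subst A c x))) (ren ?g ` (H1 - {Neg (subst A c x)}))) (ren g C)"
    by (rule derivable_ren_discharge) auto
  then have "derivable L T
      (insert (Neg (subst (ren g A) d x)) (ren g ` (H1 - {Neg (subst A c x)}))) (ren g C)"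
    unfolding eq using NAllE.hyps by (simp add: ren_subst ren_upd_fresh)
  then have "derivable L T (insert (Neg (subst (ren g A) d x)) (ren g ` ?H)) (ren g C)"
    by (rule derivable_mono) auto
  moreover have "derivable L T (ren g ` ?H) (Neg (Forall x (ren g A)))"
    using derivable_mono[OF NAllE.IH(1)[OF NAllE.prems], of "ren g ` ?H"] by auto
  ultimately show ?case using d by - (rule derivable_NAllE[of L T _ x "ren g A" d], auto)
next
  case (NExI H A c x)
  have "finite (insert (ren g A) (ren g ` H))"
    using NExI.hyps(1) deriv_hyps_finite by blast
  then obtain d where d: "d \<in> Consts T"
    "\<forall>D\<in>insert (ren g A) (ren g ` H). d \<notin> consts_fm D"
    using fresh_const[OF T] by blast
  let ?g = "g(c := d)"
  have "ren ?g ` H = ren g ` H" using NExI.hyps by (intro image_cong) (auto simp: ren_upd_fresh)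
  moreover have "derivable L T (ren ?g ` H) (ren ?g (Neg (subst A c x)))"
    using NExI.IH[OF sig_hom_upd[OF NExI.prems d(1)]] .
  ultimately have "derivable L T (ren g ` H) (Neg (subst (ren g A) d x))"
    using NExI.hyps by (simp add: ren_subst ren_upd_fresh)
  moreover have "Exists x (ren g A) \<in> Sent T" using Sent_ren[OF NExI.prems NExI.hyps(2)] by simp
  ultimately have "derivable L T (ren g ` H) (Neg (Exists x (ren g A)))"
    using d by (intro derivable_NExI) auto
  then show ?case by simp
next
  case (NExE H x A c)
  then show ?case by (auto simp: ren_subst sig_hom_def intro!: derivable_NExE)
next
  case (EqI c)
  have "derivable L T {} (Eq T (g c) (g c))"
    using EqI by (intro derivable_EqI) (auto simp: sig_hom_def)
  then show ?case using EqI by (simp add: sig_hom_def)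
next
  case (EqE H1 c1 c2 H2 A x)
  let ?G = "ren g ` (H1 \<union> H2)"
  have "derivable L T ?G (Eq T (g c1) (g c2))"
    using derivable_mono[OF EqE.IH(1)[OF EqE.prems], of ?G] EqE.prems
    by (auto simp: sig_hom_def)
  moreover have "derivable L T ?G (subst (ren g A) (g c1) x)"
    using derivable_mono[OF EqE.IH(2)[OF EqE.prems], of ?G] by (auto simp: ren_subst)
  ultimately show ?case
    using EqE derivable_EqE[of L T ?G "g c1" "g c2" "ren g A" x]
    by (simp add: ren_subst Form_ren free_vars_ren)
next
  case (EXP H1 A H2 B)
  let ?G = "ren g ` (H1 \<union> H2)"
  have "derivable L T ?G (ren g A)" "derivable L T ?G (Neg (ren g A))"
    using derivable_mono[OF EXP.IH(1)[OF EXP.prems], of ?G]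
      derivable_mono[OF EXP.IH(2)[OF EXP.prems], of ?G] by auto
  then show ?case
    by (rule derivable_EXP[OF EXP.hyps(1)]) (rule Sent_ren[OF EXP.prems EXP.hyps(4)])
next
  case (ConE1 H A B)
  then have "derivable L T (ren g ` H) (Con (ren g A) (ren g B))" by simp
  then show ?case by (rule derivable_ConE)
next
  case (ConE2 H A B)
  then have "derivable L T (ren g ` H) (Con (ren g A) (ren g B))" by simp
  then show ?case by (rule derivable_ConE)
next
  case (NDisE1 H A B)
  then have "derivable L T (ren g ` H) (Neg (Dis (ren g A) (ren g B)))" by simp
  then show ?case using derivable_NDisE(1) by fastforce
next
  case (NDisE2 H A B)
  then have "derivable L T (ren g ` H) (Neg (Dis (ren g A) (ren g B)))" by simp
  then show ?case using derivable_NDisE(2) by fastforce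
next
  case (DNE H A)
  then have "derivable L T (ren g ` H) (Neg (Neg (ren g A)))" by simp
  then show ?case by (rule derivable_DNE)
qed (simp_all add: Sent_ren derivable_DisI derivable_NConI derivable_DNI derivable_PEM)

lemma derivable_ren:
  assumes "is_signature T" and "derivable L S \<Gamma> A" and "sig_hom g S T"
  shows "derivable L T (ren g ` \<Gamma>) (ren g A)"
proof -
  obtain H where "H \<subseteq> \<Gamma>" "deriv L S H A" using assms(2) by (auto simp: derivable_def)
  then show ?thesis using deriv_ren[OF assms(1) _ assms(3)] by (meson derivable_mono image_mono)
qed


section \<open>Multiple conclusions\<close>

text \<open>Disjunctions in any bracketing and with repetitions serve to read a set of conclusions
  as one sentence. At least one disjunct is required, since there is no falsum to act as the empty
  disjunction.\<close>

inductive_set dcl :: "('c, 'p) fm set \<Rightarrow> ('c, 'p) fm set" for \<Delta> where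
  dcl_base: "A \<in> \<Delta> \<Longrightarrow> A \<in> dcl \<Delta>"
| dcl_Dis: "A \<in> dcl \<Delta> \<Longrightarrow> B \<in> dcl \<Delta> \<Longrightarrow> Dis A B \<in> dcl \<Delta>"

definition mder ::
  "logic \<Rightarrow> ('c, 'p) signature \<Rightarrow> ('c, 'p) fm set \<Rightarrow> ('c, 'p) fm set \<Rightarrow> bool" where
  "mder L S \<Gamma> \<Delta> \<longleftrightarrow> (\<exists>D\<in>dcl \<Delta>. derivable L S \<Gamma> D)"

lemma dcl_mono:
  assumes "D \<in> dcl \<Delta>" and "\<Delta> \<subseteq> \<Delta>'"
  shows "D \<in> dcl \<Delta>'"
  using assms by (induction rule: dcl.induct) (auto intro: dcl.intros)

lemma dcl_fresh:
  assumes "D \<in> dcl \<Delta>" and "\<forall>B\<in>\<Delta>. c \<notin> consts_fm B"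
  shows "c \<notin> consts_fm D"
  using assms by (induction rule: dcl.induct) auto

lemma mder_mono: "mder L S \<Gamma> \<Delta> \<Longrightarrow> \<Gamma> \<subseteq> \<Gamma>' \<Longrightarrow> \<Delta> \<subseteq> \<Delta>' \<Longrightarrow> mder L S \<Gamma>' \<Delta>'"
  unfolding mder_def using derivable_mono dcl_mono by blast

lemma mder_base: "derivable L S \<Gamma> A \<Longrightarrow> A \<in> \<Delta> \<Longrightarrow> mder L S \<Gamma> \<Delta>"
  unfolding mder_def using dcl_base by blast

text \<open>Iterated disjunction elimination. The cases may end in different members of
  \<open>X\<close>; \<open>join\<close> weakens any two of them to a common one, as the rule
  demands. \<open>X\<close> will be \<open>dcl \<Delta>\<close>, a singleton, or the disjunctions
  with a fixed right disjunct.\<close>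

lemma derivable_dcl_elim:
  assumes S: "is_signature S" and "D \<in> dcl \<Delta>" and "D \<in> Sent S"
    and base: "\<And>B. B \<in> \<Delta> \<Longrightarrow> B \<in> Sent S \<Longrightarrow> \<exists>E\<in>X. derivable L S (insert B \<Gamma>) E"
    and join: "\<And>B C. B \<in> X \<Longrightarrow> C \<in> X \<Longrightarrow> B \<in> Sent S \<Longrightarrow> C \<in> Sent S \<Longrightarrow>
      \<exists>E\<in>X. derivable L S {B} E \<and> derivable L S {C} E"
  shows "\<exists>E\<in>X. derivable L S (insert D \<Gamma>) E"
  using assms(2,3)
proof (induction rule: dcl.induct)
  case (dcl_base A)
  then show ?case using base by blast
next
  case (dcl_Dis A B)
  then obtain E1 E2 where E: "E1 \<in> X" "derivable L S (insert A \<Gamma>) E1"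
    "E2 \<in> X" "derivable L S (insert B \<Gamma>) E2" by (auto simp: Sent_iff)
  then obtain E where E': "E \<in> X" "derivable L S {E1} E" "derivable L S {E2} E"
    using join derivable_Sent[OF S] by blast
  let ?G = "insert (Dis A B) \<Gamma>"
  have "derivable L S (insert A ?G) E"
    using derivable_cut[OF S derivable_mono[OF E(2)] derivable_mono[OF E'(2)], of "insert A ?G"]
    by blast
  moreover have "derivable L S (insert B ?G) E"
    using derivable_cut[OF S derivable_mono[OF E(4)] derivable_mono[OF E'(3)], of "insert B ?G"]
    by blast
  moreover have "derivable L S ?G (Dis A B)"
    using dcl_Dis.prems by (intro derivable_Hyp) auto
  ultimately show ?case using E'(1) derivable_DisE by blast
qed

text \<open>A disjunct of the first disjunction either is \<open>A\<close>, and the second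
  derivation takes over, or already belongs to \<open>\<Delta>\<close>. The resulting conclusions
  are joined by \<open>Dis\<close>.\<close>

lemma mder_cut:
  assumes S: "is_signature S" and "mder L S \<Gamma> (insert A \<Delta>)" and "mder L S (insert A \<Gamma>) \<Delta>"
  shows "mder L S \<Gamma> \<Delta>"
proof -
  obtain D where D: "D \<in> dcl (insert A \<Delta>)" "derivable L S \<Gamma> D"
    using assms(2) by (auto simp: mder_def)
  have "\<exists>E\<in>dcl \<Delta>. derivable L S (insert D \<Gamma>) E"
  proof (rule derivable_dcl_elim[OF S D(1)])
    show "D \<in> Sent S" using derivable_Sent[OF S D(2)] .
    show "\<exists>E\<in>dcl \<Delta>. derivable L S (insert B \<Gamma>) E" if "B \<in> insert A \<Delta>" "B \<in> Sent S" for B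
      using that assms(3) by (auto simp: mder_def intro: dcl_base derivable_Hyp)
    show "\<exists>E\<in>dcl \<Delta>. derivable L S {B} E \<and> derivable L S {C} E"
      if "B \<in> dcl \<Delta>" "C \<in> dcl \<Delta>" "B \<in> Sent S" "C \<in> Sent S" for B C
      using that by (intro bexI[of _ "Dis B C"]) (auto intro: dcl_Dis derivable_DisI derivable_Hyp)
  qed
  then show ?thesis using derivable_cut[OF S D(2)] by (auto simp: mder_def)
qed

lemma mder_singleton:
  assumes S: "is_signature S" and "mder L S \<Gamma> {A}"
  shows "derivable L S \<Gamma> A"
proof -
  obtain D where D: "D \<in> dcl {A}" "derivable L S \<Gamma> D"
    using assms(2) by (auto simp: mder_def)
  have "\<exists>E\<in>{A}. derivable L S (insert D \<Gamma>) E"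
    by (rule derivable_dcl_elim[OF S D(1) derivable_Sent[OF S D(2)]])
      (auto intro: derivable_Hyp)
  then show ?thesis using derivable_cut[OF S D(2)] by blast
qed

lemma mder_finite:
  assumes "mder L S \<Gamma> \<Delta>"
  obtains \<Gamma>\<^sub>0 where "\<Gamma>\<^sub>0 \<subseteq> \<Gamma>" "finite \<Gamma>\<^sub>0" "mder L S \<Gamma>\<^sub>0 \<Delta>"
  using assms derivable_finite unfolding mder_def by meson

text \<open>All copies of \<open>P\<close> are collected into one right disjunct, the shape that
  \<forall>I asks of its premise. \<open>F\<close> supplies the left disjunct in the case where only
  \<open>P\<close> is available.\<close>

lemma derivable_Dis_of_mder:
  assumes S: "is_signature S" and "mder L S \<Gamma> (insert P \<Delta>)" and P: "P \<in> Sent S"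
    and F: "F \<in> \<Delta>" "F \<in> Sent S"
  shows "\<exists>E\<in>dcl \<Delta>. derivable L S \<Gamma> (Dis E P)"
proof -
  obtain D where D: "D \<in> dcl (insert P \<Delta>)" "derivable L S \<Gamma> D"
    using assms(2) by (auto simp: mder_def)
  let ?X = "{Dis E P | E. E \<in> dcl \<Delta>}"
  have "\<exists>E\<in>?X. derivable L S (insert D \<Gamma>) E"
  proof (rule derivable_dcl_elim[OF S D(1)])
    show "D \<in> Sent S" using derivable_Sent[OF S D(2)] .
    show "\<exists>E\<in>?X. derivable L S (insert B \<Gamma>) E" if B: "B \<in> insert P \<Delta>" "B \<in> Sent S" for B
    proof (cases "B = P")
      case True
      then have "derivable L S (insert B \<Gamma>) (Dis F P)"
        using P F by (intro derivable_DisI(2) derivable_Hyp) auto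
      then show ?thesis using F dcl_base by blast
    next
      case False
      have "derivable L S (insert B \<Gamma>) (Dis B P)"
        using B P by (intro derivable_DisI(1) derivable_Hyp) auto
      then show ?thesis using B False dcl_base by blast
    qed
    show "\<exists>E\<in>?X. derivable L S {B} E \<and> derivable L S {C} E"
      if BC: "B \<in> ?X" "C \<in> ?X" "B \<in> Sent S" "C \<in> Sent S" for B C
    proof -
      obtain E1 E2 where E: "B = Dis E1 P" "C = Dis E2 P" "E1 \<in> dcl \<Delta>" "E2 \<in> dcl \<Delta>"
        using BC by auto
      then have s: "E1 \<in> Sent S" "E2 \<in> Sent S" using BC by (auto simp: Sent_iff)
      have P': "derivable L S (insert P G) (Dis (Dis E1 E2) P)" for G
        using P s by (intro derivable_DisI(2) derivable_Hyp) (auto simp: Sent_iff)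
      have "derivable L S {B} (Dis (Dis E1 E2) P)"
      proof (rule derivable_DisE)
        show "derivable L S {B} (Dis E1 P)" using BC E by (intro derivable_Hyp) auto
        show "derivable L S (insert E1 {B}) (Dis (Dis E1 E2) P)"
          using P s by (intro derivable_DisI(1) derivable_Hyp) auto
      qed (rule P')
      moreover have "derivable L S {C} (Dis (Dis E1 E2) P)"
      proof (rule derivable_DisE)
        show "derivable L S {C} (Dis E2 P)" using BC E by (intro derivable_Hyp) auto
        show "derivable L S (insert E2 {C}) (Dis (Dis E1 E2) P)"
          using P s by (intro derivable_DisI(1)[OF derivable_DisI(2)] derivable_Hyp) auto
      qed (rule P')
      ultimately show ?thesis using E dcl_Dis by blast
    qed
  qed
  then show ?thesis using derivable_cut[OF S D(2)] by blast
qed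

lemma mder_ExE:
  assumes "mder L S (insert (subst A c x) \<Gamma>) \<Delta>" and "Exists x A \<in> \<Gamma>" "Exists x A \<in> Sent S"
    and "c \<in> Consts S" and fresh: "\<forall>B\<in>\<Gamma> \<union> \<Delta>. c \<notin> consts_fm B"
  shows "mder L S \<Gamma> \<Delta>"
proof -
  obtain D where D: "D \<in> dcl \<Delta>" "derivable L S (insert (subst A c x) \<Gamma>) D"
    using assms(1) by (auto simp: mder_def)
  have "c \<notin> consts_fm A" using bspec[OF fresh, of "Exists x A"] assms(2) by simp
  moreover have "derivable L S \<Gamma> (Exists x A)" using assms(2,3) by (rule derivable_Hyp)
  ultimately have "derivable L S \<Gamma> D"
    using assms(4) fresh dcl_fresh[OF D(1), of c] by - (rule derivable_ExE[OF _ D(2)], auto)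
  then show ?thesis using D by (auto simp: mder_def)
qed

lemma mder_NAllE:
  assumes "mder L S (insert (Neg (subst A c x)) \<Gamma>) \<Delta>"
    and "Neg (Forall x A) \<in> \<Gamma>" "Neg (Forall x A) \<in> Sent S"
    and "c \<in> Consts S" and fresh: "\<forall>B\<in>\<Gamma> \<union> \<Delta>. c \<notin> consts_fm B"
  shows "mder L S \<Gamma> \<Delta>"
proof -
  obtain D where D: "D \<in> dcl \<Delta>" "derivable L S (insert (Neg (subst A c x)) \<Gamma>) D"
    using assms(1) by (auto simp: mder_def)
  have "c \<notin> consts_fm A" using bspec[OF fresh, of "Neg (Forall x A)"] assms(2) by simp
  moreover have "derivable L S \<Gamma> (Neg (Forall x A))" using assms(2,3) by (rule derivable_Hyp)
  ultimately have "derivable L S \<Gamma> D"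
    using assms(4) fresh dcl_fresh[OF D(1), of c] by - (rule derivable_NAllE[OF _ D(2)], auto)
  then show ?thesis using D by (auto simp: mder_def)
qed

text \<open>The side disjunct of \<forall>I accommodates the remaining conclusions, gathered in
  \<open>E\<close>. As the universal sentence is itself in \<open>\<Delta>\<close>, the outcome is
  again a disjunction over \<open>\<Delta>\<close>.\<close>

lemma mder_AllI:
  assumes S: "is_signature S" and "mder L S \<Gamma> (insert (subst A c x) \<Delta>)"
    and F: "Forall x A \<in> \<Delta>" "Forall x A \<in> Sent S"
    and c: "c \<in> Consts S" and fresh: "\<forall>B\<in>\<Gamma> \<union> \<Delta>. c \<notin> consts_fm B"
  shows "mder L S \<Gamma> \<Delta>"
proof -
  obtain E where E: "E \<in> dcl \<Delta>" "derivable L S \<Gamma> (Dis E (subst A c x))"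
    using derivable_Dis_of_mder[OF S assms(2) Sent_subst(2)[OF F(2) c] F] by blast
  have "c \<notin> consts_fm A" using bspec[OF fresh, of "Forall x A"] F(1) by simp
  then have "derivable L S \<Gamma> (Dis E (Forall x A))"
    using F c fresh dcl_fresh[OF E(1), of c] by (intro derivable_AllI[OF E(2)]) auto
  then show ?thesis using E F by (auto simp: mder_def intro: dcl.intros)
qed

text \<open>\<open>\<not>\<exists>I\<close> lacks the side disjunct of \<open>\<forall>I\<close>, so the latter is applied to \<open>Neg A\<close>
  instead.\<close>

lemma mder_NExI:
  assumes S: "is_signature S" and "mder L S \<Gamma> (insert (Neg (subst A c x)) \<Delta>)"
    and F: "Neg (Exists x A) \<in> \<Delta>" "Neg (Exists x A) \<in> Sent S"
    and c: "c \<in> Consts S" and fresh: "\<forall>B\<in>\<Gamma> \<union> \<Delta>. c \<notin> consts_fm B"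
  shows "mder L S \<Gamma> \<Delta>"
proof -
  have "c \<notin> consts_fm A" using bspec[OF fresh, of "Neg (Exists x A)"] F(1) by simp
  then have A: "Forall x (Neg A) \<in> Sent S" "Exists x A \<in> Sent S" "c \<notin> consts_fm A"
    using F by (auto simp: Sent_def Form_def)
  have "Neg (subst A c x) \<in> Sent S" using Sent_subst(2)[OF A(1) c] by simp
  then obtain E where E: "E \<in> dcl \<Delta>" "derivable L S \<Gamma> (Dis E (Neg (subst A c x)))"
    using derivable_Dis_of_mder[OF S assms(2) _ F] by blast
  have "derivable L S \<Gamma> (Dis E (subst (Neg A) c x))" using E(2) by simp
  then have *: "derivable L S \<Gamma> (Dis E (Forall x (Neg A)))"
    using A c fresh dcl_fresh[OF E(1), of c] by (intro derivable_AllI) auto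
  have E': "E \<in> Sent S" using derivable_Sent[OF S *] by (simp add: Sent_iff)
  \<comment> \<open>The way back to \<open>Neg (Exists x A)\<close> runs from
    \<open>Forall x (Neg A)\<close> alone, so no side disjunct is in the way of
    \<not>\<exists>I.\<close>
  have "derivable L S {Forall x (Neg A)} (Neg (Exists x A))"
  proof (rule derivable_NExI)
    have "derivable L S {Forall x (Neg A)} (subst (Neg A) c x)"
      using A c by (intro derivable_AllE derivable_Hyp) auto
    then show "derivable L S {Forall x (Neg A)} (Neg (subst A c x))" by simp
  qed (use A c in auto)
  then have "derivable L S (insert (Forall x (Neg A)) \<Gamma>) (Neg (Exists x A))"
    by (rule derivable_mono) auto
  then have "derivable L S \<Gamma> (Dis E (Neg (Exists x A)))"
    using E' F by (intro derivable_DisE[OF *]) (auto intro: derivable_DisI derivable_Hyp)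
  then show ?thesis using E F by (auto simp: mder_def intro: dcl.intros)
qed

section \<open>Henkin constants\<close>

text \<open>Every sentence \<open>F\<close> of the extended language gets a constant \<open>Wit F\<close>. As the datatype is
  well-founded, \<open>Wit F\<close> does not occur in \<open>F\<close>.\<close>

datatype ('c, 'p) hc = Old 'c | Wit "(('c, 'p) hc, 'p) fm"

text \<open>\<open>map_fm rank id\<close> turns the constants of \<open>F\<close> into their ranks,
  which makes the recursion through formulas primitive; the added 0 is the maximum when
  \<open>F\<close> has no constants.\<close>

primrec rank :: "('c, 'p) hc \<Rightarrow> nat" where
  "rank (Old c) = 0"
| "rank (Wit F) = Suc (Max (insert 0 (consts_fm (map_fm rank id F))))"

lemma rank_Wit: "k \<in> consts_fm F \<Longrightarrow> rank k < rank (Wit F)"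
  by (simp add: fm.set_map finite_consts_fm less_Suc_eq_le)

lemma Wit_fresh: "Wit F \<notin> consts_fm F"
  using rank_Wit by blast

text \<open>The constants of \<open>F\<close> are restricted by the first premise of the second rule, so the
  second premise may admit all constants.\<close>

inductive hconst :: "('c, 'p) signature \<Rightarrow> ('c, 'p) hc \<Rightarrow> bool" for S where
  "c \<in> Consts S \<Longrightarrow> hconst S (Old c)"
| "\<forall>k\<in>consts_fm F. hconst S k \<Longrightarrow>
   F \<in> Sent \<lparr>Consts = UNIV, Preds = Preds S, arity = arity S, ident = ident S\<rparr> \<Longrightarrow>
   hconst S (Wit F)"

definition henkin_sig :: "('c, 'p) signature \<Rightarrow> (('c, 'p) hc, 'p) signature" where
  "henkin_sig S = \<lparr>Consts = {k. hconst S k}, Preds = Preds S, arity = arity S, ident = ident S\<rparr>"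

lemma is_form_consts: "is_form S A \<Longrightarrow> consts_fm A \<subseteq> Consts S"
proof (induction A)
  case (Atom P ts)
  have "t = Const c" if "c \<in> set_tm t" for t and c :: 'a using that by (cases t) auto
  then show ?case using Atom by fastforce
qed auto

lemma is_form_UNIV: "is_form S A \<Longrightarrow> is_form (S\<lparr>Consts := UNIV\<rparr>) A"
  by (induction A) auto

lemma Wit_in_henkin_sig:
  assumes "F \<in> Sent (henkin_sig S)"
  shows "Wit F \<in> Consts (henkin_sig S)"
  using assms is_form_consts[of "henkin_sig S" F] is_form_UNIV[of "henkin_sig S" F]
  by (auto simp: Sent_def Form_def henkin_sig_def intro!: hconst.intros)

lemma is_signature_henkin_sig:
  assumes "is_signature S"
  shows "is_signature (henkin_sig S)"
proof -
  have "Old ` Consts S \<subseteq> Consts (henkin_sig S)"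
    by (auto simp: henkin_sig_def intro: hconst.intros)
  moreover have "infinite (Old ` Consts S)"
    using assms by (auto simp: is_signature_def finite_image_iff inj_on_def)
  ultimately show ?thesis
    using assms by (auto simp: is_signature_def henkin_sig_def dest: finite_subset)
qed

text \<open>For an existential sentence \<open>F\<close> the Henkin rule from \<open>hprem F\<close> to \<open>hconc F\<close> says that
  \<open>Wit F\<close> is an instance of it if there is one; for a universal \<open>F\<close>, that \<open>Wit F\<close> is a
  counterexample if there is one. For all other sentences the rule is trivial.\<close>

fun hprem :: "(('c, 'p) hc, 'p) fm \<Rightarrow> (('c, 'p) hc, 'p) fm" where
  "hprem (Forall x A) = subst A (Wit (Forall x A)) x"
| "hprem (Neg (Exists x A)) = Neg (subst A (Wit (Neg (Exists x A))) x)"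
| "hprem F = F"

fun hconc :: "(('c, 'p) hc, 'p) fm \<Rightarrow> (('c, 'p) hc, 'p) fm" where
  "hconc (Exists x A) = subst A (Wit (Exists x A)) x"
| "hconc (Neg (Forall x A)) = Neg (subst A (Wit (Neg (Forall x A))) x)"
| "hconc F = F"

lemma consts_hprem: "consts_fm (hprem F) \<subseteq> insert (Wit F) (consts_fm F)"
  by (cases F rule: hprem.cases) (auto dest!: subsetD[OF consts_fm_subst])

lemma consts_hconc: "consts_fm (hconc F) \<subseteq> insert (Wit F) (consts_fm F)"
  by (cases F rule: hconc.cases) (auto dest!: subsetD[OF consts_fm_subst])

lemma hprem_Sent:
  assumes "F \<in> Sent (henkin_sig S)"
  shows "hprem F \<in> Sent (henkin_sig S)"
  using assms Wit_in_henkin_sig[OF assms] Sent_subst(2,3)[of _ _ "henkin_sig S"]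
  by (cases F rule: hprem.cases) (auto simp: Sent_iff)

lemma hconc_Sent:
  assumes "F \<in> Sent (henkin_sig S)"
  shows "hconc F \<in> Sent (henkin_sig S)"
  using assms Wit_in_henkin_sig[OF assms] Sent_subst(2,3)[of _ _ "henkin_sig S"]
  by (cases F rule: hconc.cases) (auto simp: Sent_iff)

text \<open>For \<open>Exists\<close> and \<open>Neg Forall\<close>, the elimination rule discharges
  the instance in favour of \<open>F\<close>, which is then cut against \<open>hprem F = F\<close>.
  For \<open>Forall\<close> and \<open>Neg Exists\<close>, the introduction rule turns the instance
  among the conclusions into \<open>F\<close>, which is cut against
  \<open>hconc F = F\<close>.\<close>

lemma mder_henkin_rule:
  fixes S :: "('c, 'p) signature"
  defines "T \<equiv> henkin_sig S"
  assumes S: "is_signature S" and F: "F \<in> Sent T"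
    and fresh: "\<forall>B\<in>\<Gamma> \<union> \<Delta>. Wit F \<notin> consts_fm B"
    and conc: "mder L T (insert (hconc F) \<Gamma>) \<Delta>" and prem: "mder L T \<Gamma> (insert (hprem F) \<Delta>)"
  shows "mder L T \<Gamma> \<Delta>"
proof -
  have T: "is_signature T" unfolding T_def by (rule is_signature_henkin_sig[OF S])
  have c: "Wit F \<in> Consts T" using Wit_in_henkin_sig F by (simp add: T_def)
  \<comment> \<open>The witness is fresh for \<open>F\<close> too, so \<open>F\<close> may be added
    on the side where the quantifier rule needs it.\<close>
  have fresh1: "\<forall>B\<in>insert F \<Gamma> \<union> \<Delta>. Wit F \<notin> consts_fm B"
    and fresh2: "\<forall>B\<in>\<Gamma> \<union> insert F \<Delta>. Wit F \<notin> consts_fm B"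
    using fresh Wit_fresh by auto
  have conc': "mder L T (insert (hconc F) (insert F \<Gamma>)) \<Delta>"
    by (rule mder_mono[OF conc]) auto
  have prem': "mder L T \<Gamma> (insert (hprem F) (insert F \<Delta>))"
    by (rule mder_mono[OF prem]) auto
  consider (Ex) x A where "F = Exists x A" | (NAll) x A where "F = Neg (Forall x A)"
    | (All) x A where "F = Forall x A" | (NEx) x A where "F = Neg (Exists x A)"
    | (other) "hconc F = F" "hprem F = F"
    by (cases F rule: hconc.cases; cases F rule: hprem.cases) auto
  then show ?thesis
  proof cases
    case Ex
    have "mder L T (insert F \<Gamma>) \<Delta>"
      using conc' F c fresh1 unfolding Ex by - (rule mder_ExE[of L T A "Wit (Exists x A)" x], auto)
    then show ?thesis using mder_cut[OF T] prem Ex by simp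
  next
    case NAll
    have "mder L T (insert F \<Gamma>) \<Delta>"
      using conc' F c fresh1 unfolding NAll
      by - (rule mder_NAllE[of L T A "Wit (Neg (Forall x A))" x], auto)
    then show ?thesis using mder_cut[OF T] prem NAll by simp
  next
    case All
    have "mder L T \<Gamma> (insert F \<Delta>)"
      using prem' F c fresh2 unfolding All
      by - (rule mder_AllI[OF T, of L _ A "Wit (Forall x A)" x], auto)
    then show ?thesis using mder_cut[OF T] conc All by simp
  next
    case NEx
    have "mder L T \<Gamma> (insert F \<Delta>)"
      using prem' F c fresh2 unfolding NEx
      by - (rule mder_NExI[OF T, of L _ A "Wit (Neg (Exists x A))" x], auto)
    then show ?thesis using mder_cut[OF T] conc NEx by simp
  next
    case other
    then show ?thesis using mder_cut[OF T] conc prem by simp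
  qed
qed

lemma henkin_conservative:
  fixes S :: "('c, 'p) signature"
  defines "T \<equiv> henkin_sig S"
  assumes S: "is_signature S" and "finite F" and "F \<subseteq> Sent T"
    and fresh: "\<forall>B\<in>\<Gamma> \<union> \<Delta>. \<forall>f. Wit f \<notin> consts_fm B"
    and "\<forall>I\<subseteq>F. mder L T (\<Gamma> \<union> hconc ` I) (\<Delta> \<union> hprem ` (F - I))"
  shows "mder L T \<Gamma> \<Delta>"
  using assms(3,4,6)
proof (induction F rule: finite_ranking_induct[where f = "\<lambda>f. rank (Wit f)"])
  case empty
  then show ?case by simp
next
  case (insert x F)
  show ?case
  proof (cases "x \<in> F")
    case True
    then show ?thesis using insert by (simp add: insert_absorb)
  next
    case False
    have "mder L T (\<Gamma> \<union> hconc ` I) (\<Delta> \<union> hprem ` (F - I))" if I: "I \<subseteq> F" for I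
    proof (rule mder_henkin_rule[OF S, of x, folded T_def])
      show "x \<in> Sent T" using insert.prems by simp
      \<comment> \<open>The formulas of the rule for \<open>f\<close> contain, besides the constants
        of \<open>f\<close>, at most \<open>Wit f\<close>. This differs from \<open>Wit x\<close>,
        and an occurrence of \<open>Wit x\<close> in \<open>f\<close> would give
        \<open>Wit f\<close> a rank above that of \<open>Wit x\<close>, which is the
        largest.\<close>
      have "Wit x \<notin> consts_fm B" if f: "f \<in> F" and B: "B = hconc f \<or> B = hprem f" for f B
      proof
        assume "Wit x \<in> consts_fm B"
        then have "Wit x \<in> consts_fm f"
          using f B False consts_hconc[of f] consts_hprem[of f] by auto
        then show False using insert.hyps(2)[OF f] rank_Wit by (metis not_less)
      qed
      then show "\<forall>B\<in>(\<Gamma> \<union> hconc ` I) \<union> (\<Delta> \<union> hprem ` (F - I)). Wit x \<notin> consts_fm B"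
        using fresh I by auto
      \<comment> \<open>The choices with and without \<open>x\<close> provide the two premises of
        the elimination step for \<open>x\<close>.\<close>
      have "insert x F - insert x I = F - I" using False by auto
      then show "mder L T (insert (hconc x) (\<Gamma> \<union> hconc ` I)) (\<Delta> \<union> hprem ` (F - I))"
        using insert.prems(2)[rule_format, of "insert x I"] I by auto
      have "insert x F - I = insert x (F - I)" using False I by auto
      then show "mder L T (\<Gamma> \<union> hconc ` I) (insert (hprem x) (\<Delta> \<union> hprem ` (F - I)))"
        using insert.prems(2)[rule_format, of I] I by auto
    qed
    then show ?thesis using insert.IH insert.prems(1) by auto
  qed
qed

text \<open>Derivability with Henkin rules. A rule from \<open>P\<close> to \<open>R\<close> acts like \<open>P \<longrightarrow> R\<close>, which is
  not expressible: for each used rule one may either assume \<open>R\<close> or add \<open>P\<close> to the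
  conclusions, and a derivation is needed for each of these choices.\<close>

definition hder ::
  "logic \<Rightarrow> ('c, 'p) signature \<Rightarrow> (('c, 'p) hc, 'p) fm set \<Rightarrow> (('c, 'p) hc, 'p) fm set \<Rightarrow> bool"
  where
  "hder L S \<Gamma> \<Delta> \<longleftrightarrow> (\<exists>F. finite F \<and> F \<subseteq> Sent (henkin_sig S) \<and>
     (\<forall>I\<subseteq>F. mder L (henkin_sig S) (\<Gamma> \<union> hconc ` I) (\<Delta> \<union> hprem ` (F - I))))"

section \<open>Cut, closure under Henkin rules and finiteness for \<open>hder\<close>\<close>

lemma hder_of_mder: "mder L (henkin_sig S) \<Gamma> \<Delta> \<Longrightarrow> hder L S \<Gamma> \<Delta>"
  unfolding hder_def by (rule exI[of _ "{}"]) simp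

lemma hder_mono: "hder L S \<Gamma> \<Delta> \<Longrightarrow> \<Gamma> \<subseteq> \<Gamma>' \<Longrightarrow> \<Delta> \<subseteq> \<Delta>' \<Longrightarrow> hder L S \<Gamma>' \<Delta>'"
  unfolding hder_def by (meson mder_mono Un_mono order_refl)

text \<open>The Henkin rules used in the two derivations are pooled; each choice for the union
  restricts to a choice for either part, and \<open>mder_cut\<close> applies choice by
  choice.\<close>

lemma hder_cut:
  assumes S: "is_signature S"
    and "hder L S \<Gamma> (insert A \<Delta>)" and "hder L S (insert A \<Gamma>) \<Delta>"
  shows "hder L S \<Gamma> \<Delta>"
proof -
  let ?T = "henkin_sig S"
  obtain F G where F: "finite F" "F \<subseteq> Sent ?T"
    "\<And>I. I \<subseteq> F \<Longrightarrow> mder L ?T (\<Gamma> \<union> hconc ` I) (insert A \<Delta> \<union> hprem ` (F - I))"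
    and G: "finite G" "G \<subseteq> Sent ?T"
    "\<And>I. I \<subseteq> G \<Longrightarrow> mder L ?T (insert A \<Gamma> \<union> hconc ` I) (\<Delta> \<union> hprem ` (G - I))"
    using assms(2,3) unfolding hder_def by blast
  have "mder L ?T (\<Gamma> \<union> hconc ` I) (\<Delta> \<union> hprem ` (F \<union> G - I))" if "I \<subseteq> F \<union> G" for I
  proof (rule mder_cut[OF is_signature_henkin_sig[OF S]])
    show "mder L ?T (\<Gamma> \<union> hconc ` I) (insert A (\<Delta> \<union> hprem ` (F \<union> G - I)))"
      by (rule mder_mono[OF F(3)[of "I \<inter> F"]]) auto
    show "mder L ?T (insert A (\<Gamma> \<union> hconc ` I)) (\<Delta> \<union> hprem ` (F \<union> G - I))"
      by (rule mder_mono[OF G(3)[of "I \<inter> G"]]) auto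
  qed
  then show ?thesis unfolding hder_def using F G by (intro exI[of _ "F \<union> G"]) auto
qed

text \<open>The rule for \<open>F\<close> is added to those used: where its conclusion is assumed,
  the given derivation serves; where its premise joins the conclusions, that premise is already a
  hypothesis.\<close>

lemma hder_henkin_rule:
  assumes F: "F \<in> Sent (henkin_sig S)" and "hprem F \<in> \<Gamma>"
    and "hder L S (insert (hconc F) \<Gamma>) \<Delta>"
  shows "hder L S \<Gamma> \<Delta>"
proof -
  let ?T = "henkin_sig S"
  obtain G where G: "finite G" "G \<subseteq> Sent ?T"
    "\<And>I. I \<subseteq> G \<Longrightarrow> mder L ?T (insert (hconc F) \<Gamma> \<union> hconc ` I) (\<Delta> \<union> hprem ` (G - I))"
    using assms(3) unfolding hder_def by blast
  have "mder L ?T (\<Gamma> \<union> hconc ` I) (\<Delta> \<union> hprem ` (insert F G - I))" if I: "I \<subseteq> insert F G" for I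
  proof (cases "F \<in> I")
    case True
    then show ?thesis by (intro mder_mono[OF G(3)[of "I \<inter> G"]]) auto
  next
    case False
    have "derivable L ?T (\<Gamma> \<union> hconc ` I) (hprem F)"
      using assms(2) hprem_Sent[OF F] by (intro derivable_Hyp) auto
    then show ?thesis by (rule mder_base) (use False in auto)
  qed
  then show ?thesis unfolding hder_def using F G by (intro exI[of _ "insert F G"]) auto
qed

text \<open>There are only finitely many choices \<open>I\<close>, and each calls for finitely many
  hypotheses.\<close>

lemma hder_finite:
  assumes "hder L S \<Gamma> \<Delta>"
  obtains \<Gamma>\<^sub>0 where "\<Gamma>\<^sub>0 \<subseteq> \<Gamma>" "finite \<Gamma>\<^sub>0" "hder L S \<Gamma>\<^sub>0 \<Delta>"
proof -
  let ?T = "henkin_sig S"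
  obtain F where F: "finite F" "F \<subseteq> Sent ?T"
    "\<And>I. I \<subseteq> F \<Longrightarrow> mder L ?T (\<Gamma> \<union> hconc ` I) (\<Delta> \<union> hprem ` (F - I))"
    using assms unfolding hder_def by blast
  have "\<exists>G. G \<subseteq> \<Gamma> \<and> finite G \<and> mder L ?T (G \<union> hconc ` I) (\<Delta> \<union> hprem ` (F - I))"
    if I: "I \<subseteq> F" for I
  proof -
    obtain G where G: "G \<subseteq> \<Gamma> \<union> hconc ` I" "finite G"
      "mder L ?T G (\<Delta> \<union> hprem ` (F - I))"
      using mder_finite[OF F(3)[OF I]] .
    have "mder L ?T (G \<inter> \<Gamma> \<union> hconc ` I) (\<Delta> \<union> hprem ` (F - I))"
      by (rule mder_mono[OF G(3)]) (use G(1) in auto)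
    then show ?thesis using G(2) by (intro exI[of _ "G \<inter> \<Gamma>"]) auto
  qed
  then obtain g where g: "\<And>I. I \<subseteq> F \<Longrightarrow> g I \<subseteq> \<Gamma> \<and> finite (g I) \<and>
      mder L ?T (g I \<union> hconc ` I) (\<Delta> \<union> hprem ` (F - I))"
    by metis
  let ?G = "\<Union>I\<in>Pow F. g I"
  have "mder L ?T (?G \<union> hconc ` I) (\<Delta> \<union> hprem ` (F - I))" if "I \<subseteq> F" for I
    by (rule mder_mono[of L ?T "g I \<union> hconc ` I"]) (use g[OF that] that in auto)
  then have "hder L S ?G \<Delta>" unfolding hder_def using F by (intro exI[of _ F]) auto
  moreover have "?G \<subseteq> \<Gamma>" "finite ?G" using g F(1) by auto
  ultimately show ?thesis using that by blast
qed

lemma sig_hom_Old: "sig_hom Old S (henkin_sig S)"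
  by (auto simp: sig_hom_def henkin_sig_def intro: hconst.intros)

lemma derivable_of_hder:
  fixes S :: "('c, 'p) signature"
  assumes S: "is_signature S" and "hder L S (ren Old ` \<Gamma>) {ren Old A}"
  shows "derivable L S \<Gamma> A"
proof -
  let ?T = "henkin_sig S"
  have "mder L ?T (ren Old ` \<Gamma>) {ren Old A}"
  proof -
    obtain F where F: "finite F" "F \<subseteq> Sent ?T"
      "\<forall>I\<subseteq>F. mder L ?T (ren Old ` \<Gamma> \<union> hconc ` I) ({ren Old A} \<union> hprem ` (F - I))"
      using assms(2) unfolding hder_def by (elim exE conjE)
    show ?thesis by (rule henkin_conservative[OF S F(1,2) _ F(3)]) (auto simp: fm.set_map)
  qed
  then have d: "derivable L ?T (ren Old ` \<Gamma>) (ren Old A)"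
    by (rule mder_singleton[OF is_signature_henkin_sig[OF S]])
  obtain c where c: "c \<in> Consts S" using fresh_const[OF S, of "{}"] by auto
  \<comment> \<open>Derivations may still pass through witnesses. They are all sent to one old
    constant, while old sentences return to themselves.\<close>
  define g :: "('c, 'p) hc \<Rightarrow> 'c" where "g = (\<lambda>k. case k of Old a \<Rightarrow> a | Wit F \<Rightarrow> c)"
  have "g k \<in> Consts S" if "hconst S k" for k
    using that by cases (auto simp: g_def c)
  then have "sig_hom g ?T S" by (auto simp: sig_hom_def henkin_sig_def)
  then have "derivable L S (ren g ` ren Old ` \<Gamma>) (ren g (ren Old A))"
    using derivable_ren[OF S d] by blast
  moreover have "ren g (ren Old B) = B" for B :: "('c, 'p) fm"
    by (simp add: fm.map_comp o_def g_def fm.map_ident)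
  ultimately show ?thesis by (simp add: image_image)
qed


section \<open>Prime Henkin theories\<close>

text \<open>A sentence outside \<open>X\<close> need not have its negation in \<open>X\<close>, so
  counterexamples to universal sentences outside \<open>X\<close> are demanded separately from
  witnesses for existential sentences in \<open>X\<close>.\<close>

locale henkin_theory =
  fixes L :: logic and T :: "('k, 'p) signature" and X :: "('k, 'p) fm set"
  assumes sig: "is_signature T"
    and sent: "X \<subseteq> Sent T"
    and closed: "derivable L T X A \<Longrightarrow> A \<in> X"
    and prime: "Dis A B \<in> X \<Longrightarrow> A \<in> X \<or> B \<in> X"
    and proper: "X \<noteq> Sent T"
    and wit_Exists: "Exists x A \<in> X \<Longrightarrow> \<exists>c\<in>Consts T. subst A c x \<in> X"
    and wit_NForall: "Neg (Forall x A) \<in> X \<Longrightarrow> \<exists>c\<in>Consts T. Neg (subst A c x) \<in> X"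
    and wit_Forall: "Forall x A \<in> Sent T \<Longrightarrow> Forall x A \<notin> X \<Longrightarrow>
      \<exists>c\<in>Consts T. subst A c x \<notin> X"
    and wit_NExists: "Exists x A \<in> Sent T \<Longrightarrow> Neg (Exists x A) \<notin> X \<Longrightarrow>
      \<exists>c\<in>Consts T. Neg (subst A c x) \<notin> X"

text \<open>Zorn's lemma: by \<open>hder_finite\<close>, a derivation from the union of a chain
  already is one from some member of the chain.\<close>

lemma hder_maximal:
  assumes "\<Gamma> \<subseteq> Sent (henkin_sig S)" and "\<not> hder L S \<Gamma> \<Delta>"
  obtains X where "\<Gamma> \<subseteq> X" "X \<subseteq> Sent (henkin_sig S)" "\<not> hder L S X \<Delta>"
    "\<And>C. C \<in> Sent (henkin_sig S) \<Longrightarrow> C \<notin> X \<Longrightarrow> hder L S (insert C X) \<Delta>"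
proof -
  let ?M = "{Y. \<Gamma> \<subseteq> Y \<and> Y \<subseteq> Sent (henkin_sig S) \<and> \<not> hder L S Y \<Delta>}"
  have union: "\<Union>C \<in> ?M" if C: "C \<noteq> {}" "subset.chain ?M C" for C
  proof -
    have sub: "C \<subseteq> ?M" using C(2) by (simp add: subset.chain_def)
    have "\<not> hder L S (\<Union>C) \<Delta>"
    proof
      assume "hder L S (\<Union>C) \<Delta>"
      then obtain G where G: "G \<subseteq> \<Union>C" "finite G" "hder L S G \<Delta>" by (rule hder_finite)
      obtain Y where Y: "Y \<in> C" "G \<subseteq> Y" using finite_subset_Union_chain[OF G(2,1) C] .
      have "hder L S Y \<Delta>" by (rule hder_mono[OF G(3) Y(2) order_refl])
      then show False using sub Y(1) by auto
    qed
    moreover have "\<Gamma> \<subseteq> \<Union>C" using sub C(1) by auto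
    moreover have "\<Union>C \<subseteq> Sent (henkin_sig S)" using sub by auto
    ultimately show ?thesis by simp
  qed
  have "?M \<noteq> {}" using assms by auto
  from subset_Zorn_nonempty[OF this union]
  obtain X where X: "X \<in> ?M" "\<And>Y. Y \<in> ?M \<Longrightarrow> X \<subseteq> Y \<Longrightarrow> Y = X" by meson
  have "hder L S (insert C X) \<Delta>" if C: "C \<in> Sent (henkin_sig S)" "C \<notin> X" for C
  proof (rule ccontr)
    assume "\<not> hder L S (insert C X) \<Delta>"
    then have "insert C X \<in> ?M" using X(1) C(1) by auto
    then show False using X(2)[of "insert C X"] C(2) by auto
  qed
  then show ?thesis using X(1) that by auto
qed

text \<open>By maximality, every sentence outside \<open>X\<close> yields \<open>ren Old A\<close>
  when added. One cut then gives closure under derivability, and two cuts give primeness.\<close>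

lemma henkin_theory_exists:
  assumes S: "is_signature S" and "\<Gamma> \<subseteq> Sent S" and A: "A \<in> Sent S"
    and "\<not> derivable L S \<Gamma> A"
  obtains X where "henkin_theory L (henkin_sig S) X" "ren Old ` \<Gamma> \<subseteq> X" "ren Old A \<notin> X"
proof -
  let ?T = "henkin_sig S" and ?A = "ren Old A"
  have T: "is_signature ?T" by (rule is_signature_henkin_sig[OF S])
  have "ren Old ` \<Gamma> \<subseteq> Sent ?T" using assms(2) Sent_ren[OF sig_hom_Old] by blast
  then obtain X where X: "ren Old ` \<Gamma> \<subseteq> X" "X \<subseteq> Sent ?T" "\<not> hder L S X {?A}"
    and max: "\<And>C. C \<in> Sent ?T \<Longrightarrow> C \<notin> X \<Longrightarrow> hder L S (insert C X) {?A}"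
  proof (rule hder_maximal)
    show "\<not> hder L S (ren Old ` \<Gamma>) {?A}" using derivable_of_hder[OF S] assms(4) by blast
  qed (rule that)
  have mem: "C \<in> X" if "C \<in> Sent ?T" "\<not> hder L S (insert C X) {?A}" for C
    using max[OF that(1)] that(2) by auto
  have closed: "C \<in> X" if "derivable L ?T X C" for C
  proof (rule mem)
    show "C \<in> Sent ?T" using derivable_Sent[OF T that] .
    have "hder L S X {C, ?A}" by (rule hder_of_mder, rule mder_base[OF that]) simp
    then show "\<not> hder L S (insert C X) {?A}" using hder_cut[OF S, of L X C "{?A}"] X(3) by auto
  qed
  have prime: "B \<in> X \<or> C \<in> X" if BC: "Dis B C \<in> X" for B C
  proof (rule ccontr)
    assume n: "\<not> (B \<in> X \<or> C \<in> X)"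
    have s: "B \<in> Sent ?T" "C \<in> Sent ?T" using BC X(2) by (auto simp: Sent_iff)
    have "mder L ?T X {B, C}"
      unfolding mder_def using BC X(2)
      by (intro bexI[of _ "Dis B C"] derivable_Hyp) (auto intro: dcl.intros)
    then have "hder L S X {B, C, ?A}" by (intro hder_mono[OF hder_of_mder]) auto
    moreover have "hder L S (insert B X) {C, ?A}"
      by (rule hder_mono[OF max[OF s(1)]]) (use n in auto)
    ultimately have "hder L S X {C, ?A}" by (rule hder_cut[OF S])
    then show False using hder_cut[OF S, of L X C "{?A}"] max[OF s(2)] n X(3) by auto
  qed
  \<comment> \<open>\<open>X\<close> is closed under the Henkin rules. For existential forms this
    directly gives the witness; for universal forms it is contraposed: if the universal sentence is
    missing, so is its instance at \<open>Wit F\<close>.\<close>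
  have henkin: "hconc F \<in> X" if "F \<in> Sent ?T" "hprem F \<in> X" for F
    using mem[OF hconc_Sent[OF that(1)]] hder_henkin_rule[OF that, of L "{?A}"] X(3) by auto
  have A': "?A \<in> Sent ?T" using Sent_ren[OF sig_hom_Old A] .
  then have notin: "?A \<notin> X"
    using X(3) hder_of_mder[OF mder_base[OF derivable_Hyp], of ?A X S "{?A}" L] by auto
  have "henkin_theory L ?T X"
  proof
    show "X \<noteq> Sent ?T" using A' notin by blast
    fix x B
    {
      assume *: "Exists x B \<in> X"
      then show "\<exists>c\<in>Consts ?T. subst B c x \<in> X"
        using henkin[of "Exists x B"] X(2) Wit_in_henkin_sig[of "Exists x B" S] by auto
    next
      assume *: "Neg (Forall x B) \<in> X"
      then show "\<exists>c\<in>Consts ?T. Neg (subst B c x) \<in> X"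
        using henkin[of "Neg (Forall x B)"] X(2) Wit_in_henkin_sig[of "Neg (Forall x B)" S]
        by auto
    next
      assume *: "Forall x B \<in> Sent ?T" "Forall x B \<notin> X"
      then show "\<exists>c\<in>Consts ?T. subst B c x \<notin> X"
        using henkin[of "Forall x B"] Wit_in_henkin_sig[of "Forall x B" S] by auto
    next
      assume *: "Exists x B \<in> Sent ?T" "Neg (Exists x B) \<notin> X"
      then show "\<exists>c\<in>Consts ?T. Neg (subst B c x) \<notin> X"
        using henkin[of "Neg (Exists x B)"] Wit_in_henkin_sig[of "Neg (Exists x B)" S]
        by (auto simp: Sent_iff)
    }
  qed (use T X(2) closed prime in auto)
  then show ?thesis using X(1) notin that by blast
qed

section \<open>Membership in a prime Henkin theory obeys the clauses of a valuation\<close>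

context henkin_theory
begin

lemma hyp: "A \<in> X \<Longrightarrow> derivable L T X A"
  using sent by (auto intro: derivable_Hyp)

lemma Con_mem: "Con A B \<in> X \<longleftrightarrow> A \<in> X \<and> B \<in> X"
  by (meson hyp closed derivable_ConI derivable_ConE)

lemma Dis_mem:
  assumes "Dis A B \<in> Sent T"
  shows "Dis A B \<in> X \<longleftrightarrow> A \<in> X \<or> B \<in> X"
proof -
  have "A \<in> Sent T" "B \<in> Sent T" using assms by (auto simp: Sent_iff)
  then show ?thesis by (meson hyp closed prime derivable_DisI)
qed

lemma NCon_mem:
  assumes "Con A B \<in> Sent T"
  shows "Neg (Con A B) \<in> X \<longleftrightarrow> Neg A \<in> X \<or> Neg B \<in> X"
proof -
  have s: "A \<in> Sent T" "B \<in> Sent T" using assms by (auto simp: Sent_iff)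
  have "Neg A \<in> X \<or> Neg B \<in> X" if "Neg (Con A B) \<in> X"
  proof (intro prime closed derivable_NConE[OF hyp[OF that]])
    show "derivable L T (insert (Neg A) X) (Dis (Neg A) (Neg B))"
      using s by (intro derivable_DisI(1) derivable_Hyp) (auto simp: Sent_iff)
    show "derivable L T (insert (Neg B) X) (Dis (Neg A) (Neg B))"
      using s by (intro derivable_DisI(2) derivable_Hyp) (auto simp: Sent_iff)
  qed
  moreover have "Neg (Con A B) \<in> X" if "Neg A \<in> X \<or> Neg B \<in> X"
    using that s by (meson hyp closed derivable_NConI)
  ultimately show ?thesis by blast
qed

lemma NDis_mem: "Neg (Dis A B) \<in> X \<longleftrightarrow> Neg A \<in> X \<and> Neg B \<in> X"
  by (meson hyp closed derivable_NDisI derivable_NDisE)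

lemma DN_mem: "Neg (Neg A) \<in> X \<longleftrightarrow> A \<in> X"
  by (meson hyp closed derivable_DNI derivable_DNE)

lemma Forall_mem:
  "Forall x A \<in> Sent T \<Longrightarrow> Forall x A \<in> X \<longleftrightarrow> (\<forall>c\<in>Consts T. subst A c x \<in> X)"
  by (meson hyp closed derivable_AllE wit_Forall)

lemma Exists_mem:
  "Exists x A \<in> Sent T \<Longrightarrow> Exists x A \<in> X \<longleftrightarrow> (\<exists>c\<in>Consts T. subst A c x \<in> X)"
  by (meson hyp closed derivable_ExI wit_Exists)

lemma NForall_mem:
  "Forall x A \<in> Sent T \<Longrightarrow> Neg (Forall x A) \<in> X \<longleftrightarrow> (\<exists>c\<in>Consts T. Neg (subst A c x) \<in> X)"
  by (meson hyp closed derivable_NAllI wit_NForall)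

lemma NExists_mem:
  "Exists x A \<in> Sent T \<Longrightarrow> Neg (Exists x A) \<in> X \<longleftrightarrow> (\<forall>c\<in>Consts T. Neg (subst A c x) \<in> X)"
  by (meson hyp closed derivable_NExE wit_NExists)

section \<open>Identity is a congruence on the constants\<close>

lemma Eq_consts: "Eq T c d \<in> X \<Longrightarrow> c \<in> Consts T \<and> d \<in> Consts T"
  using sent Sent_Eq[OF sig] by blast

lemma Eq_replace:
  "Eq T c d \<in> X \<Longrightarrow> subst A c x \<in> X \<Longrightarrow> A \<in> Form T \<Longrightarrow> free_vars A \<subseteq> {x} \<Longrightarrow> subst A d x \<in> X"
  by (rule closed) (rule derivable_EqE[OF hyp hyp])

lemma Eq_refl: "c \<in> Consts T \<Longrightarrow> Eq T c c \<in> X"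
  by (rule closed) (rule derivable_EqI)

lemma Eq_sym:
  assumes "Eq T c d \<in> X"
  shows "Eq T d c \<in> X"
proof -
  \<comment> \<open>\<open>Var 0\<close> marks the place of replacement; the instance at
    \<open>c\<close> is reflexivity.\<close>
  have "subst (Atom (ident T) [Var 0, Const c]) d 0 \<in> X"
    using assms sig Eq_consts[OF assms] Eq_refl
    by (intro Eq_replace[OF assms]) (auto simp: Form_def is_signature_def)
  then show ?thesis by simp
qed

lemma Eq_trans:
  assumes "Eq T c d \<in> X" and "Eq T d e \<in> X"
  shows "Eq T c e \<in> X"
proof -
  have "subst (Atom (ident T) [Const c, Var 0]) e 0 \<in> X"
    using assms sig Eq_consts[OF assms(1)]
    by (intro Eq_replace[OF assms(2)]) (auto simp: Form_def is_signature_def)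
  then show ?thesis by simp
qed

definition lit :: "bool \<Rightarrow> 'p \<Rightarrow> 'k tm list \<Rightarrow> ('k, 'p) fm" where
  "lit b P ts = (if b then Atom P ts else Neg (Atom P ts))"

lemma lit_Sent:
  "lit b P (map Const cs) \<in> Sent T \<longleftrightarrow>
     P \<in> Preds T \<and> length cs = arity T P \<and> set cs \<subseteq> Consts T"
  by (auto simp: lit_def Sent_def Form_def)

text \<open>Arguments are replaced one at a time from the left; \<open>es\<close> holds those
  already treated and therefore varies in the induction.\<close>

lemma lit_replace:
  assumes "list_all2 (\<lambda>c d. Eq T c d \<in> X) cs ds" and "lit b P (map Const (es @ cs)) \<in> X"
  shows "lit b P (map Const (es @ ds)) \<in> X"
  using assms
proof (induction arbitrary: es rule: list_all2_induct)
  case (Cons c cs d ds)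
  let ?A = "lit b P (map Const es @ Var 0 # map Const cs)"
  have s: "subst ?A a 0 = lit b P (map Const (es @ a # cs))" for a
    by (auto simp: lit_def)
  have "lit b P (map Const (es @ c # cs)) \<in> Sent T" using Cons.prems sent by blast
  then have "?A \<in> Form T" "free_vars ?A \<subseteq> {0}"
    unfolding lit_Sent by (auto simp: lit_def Form_def)
  then have "subst ?A d 0 \<in> X"
    using Cons.prems by (intro Eq_replace[OF Cons.hyps(1)]) (simp_all only: s)
  then show ?case using Cons.IH[of "es @ [d]"] by (simp add: s)
qed simp

end

text \<open>The elements of the canonical structure are the images under \<open>h\<close> of representatives of the
  constants modulo \<open>Eq\<close>; \<open>h\<close> moves them into a prescribed type.\<close>

locale henkin_model = henkin_theory L T X
  for L :: logic and T :: "('k, 'p) signature" and X :: "('k, 'p) fm set" +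
  fixes h :: "'k \<Rightarrow> 'd"
  assumes inj: "inj_on h (Consts T)"
begin

section \<open>The canonical structure and its truth lemma\<close>

definition val_const :: "'k \<Rightarrow> 'd" where
  "val_const c = h (SOME d. Eq T c d \<in> X)"

text \<open>Identified constants have the same class, from which \<open>SOME\<close> picks the same
  representative; conversely, \<open>h\<close> keeps distinct representatives apart.\<close>

lemma val_const_eq:
  assumes "c \<in> Consts T" and "d \<in> Consts T"
  shows "val_const c = val_const d \<longleftrightarrow> Eq T c d \<in> X"
proof
  assume "Eq T c d \<in> X"
  then have "(\<lambda>e. Eq T c e \<in> X) = (\<lambda>e. Eq T d e \<in> X)"
    using Eq_sym Eq_trans by blast
  then show "val_const c = val_const d" by (simp add: val_const_def)
next
  let ?r = "\<lambda>c. SOME d. Eq T c d \<in> X"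
  have r: "Eq T e (?r e) \<in> X" if "e \<in> Consts T" for e
    using Eq_refl[OF that] by (rule someI)
  assume "val_const c = val_const d"
  then have "?r c = ?r d"
    using inj Eq_consts[OF r[OF assms(1)]] Eq_consts[OF r[OF assms(2)]]
    by (simp add: val_const_def inj_on_eq_iff)
  then show "Eq T c d \<in> X" using r[OF assms(1)] r[OF assms(2)] Eq_sym Eq_trans by metis
qed

text \<open>The parameter \<open>g\<close> says which constant of \<open>T\<close> interprets a
  given letter, so that a theory in the extended language yields a structure for the original
  signature.\<close>

definition canon :: "('e \<Rightarrow> 'k) \<Rightarrow> ('e, 'p, 'd) struct" where
  "canon g = \<lparr>Dom = val_const ` Consts T, cint = val_const \<circ> g,
     pos = \<lambda>P. {map val_const cs | cs. lit True P (map Const cs) \<in> X},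
     neg = \<lambda>P. {map val_const cs | cs. lit False P (map Const cs) \<in> X}\<rparr>"

text \<open>The extensions ask for some constants naming the tuple; by \<open>lit_replace\<close> it
  does not matter which names are taken.\<close>

lemma lit_mem:
  assumes "set cs \<subseteq> Consts T"
  shows "map val_const cs \<in> {map val_const ds | ds. lit b P (map Const ds) \<in> X} \<longleftrightarrow>
    lit b P (map Const cs) \<in> X"
proof
  assume "map val_const cs \<in> {map val_const ds | ds. lit b P (map Const ds) \<in> X}"
  then obtain ds where ds: "map val_const ds = map val_const cs" "lit b P (map Const ds) \<in> X"
    by force
  have "lit b P (map Const ds) \<in> Sent T" using ds(2) sent by blast
  then have "set ds \<subseteq> Consts T" by (simp add: lit_Sent)
  then have "list_all2 (\<lambda>c d. Eq T c d \<in> X) ds cs"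
    using ds(1) assms val_const_eq
    by (auto simp: list_all2_conv_all_nth list_eq_iff_nth_eq subset_iff)
  from lit_replace[OF this, of b P "[]"] ds(2) show "lit b P (map Const cs) \<in> X" by simp
qed blast

text \<open>\<open>A\<close> and \<open>Neg A\<close> are treated together because falsity is not
  the absence of truth. The induction is on size, since the quantifier cases need instances, which
  are not subformulas but have the size of the body.\<close>

lemma truth:
  assumes "A \<in> Sent T"
  shows "(A \<in> X \<longleftrightarrow> ev (canon g) val_const True e A) \<and>
    (Neg A \<in> X \<longleftrightarrow> ev (canon g) val_const False e A)"
  using assms
proof (induction A arbitrary: e rule: measure_induct_rule[of size])
  case (less A)
  show ?case
  proof (cases A)
    case (Atom P ts)
    have "Var x \<notin> set ts" for x using less.prems Atom by (auto simp: Sent_def)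
    then have "\<forall>t\<in>set ts. \<exists>c. t = Const c" by (metis tm.exhaust)
    then obtain cs where cs: "ts = map Const cs" by (auto simp: ex_map_conv[symmetric])
    have "set cs \<subseteq> Consts T"
      using less.prems lit_Sent[of True P cs] by (simp add: Atom cs lit_def)
    from lit_mem[OF this, of True P] lit_mem[OF this, of False P] show ?thesis
      by (simp add: Atom cs canon_def lit_def o_def)
  next
    case (Neg B)
    then show ?thesis using less.IH[of B e] less.prems by (auto simp: Sent_iff DN_mem)
  next
    case (Con B C)
    then show ?thesis
      using less.IH[of B e] less.IH[of C e] less.prems Con_mem[of B C] NCon_mem[of B C]
      by (auto simp: Sent_iff)
  next
    case (Dis B C)
    then show ?thesis
      using less.IH[of B e] less.IH[of C e] less.prems Dis_mem[of B C] NDis_mem[of B C]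
      by (auto simp: Sent_iff)
  next
    case (Forall x B)
    have "(subst B c x \<in> X \<longleftrightarrow> ev (canon g) val_const True (e(x := val_const c)) B) \<and>
        (Neg (subst B c x) \<in> X \<longleftrightarrow> ev (canon g) val_const False (e(x := val_const c)) B)"
      if "c \<in> Consts T" for c
      using less.IH[of "subst B c x" e] Sent_subst(2)[of x B T c] less.prems that
      unfolding Forall ev_subst by simp
    then show ?thesis
      using less.prems Forall_mem[of x B] NForall_mem[of x B]
      unfolding Forall by (simp add: canon_def)
  next
    case (Exists x B)
    have "(subst B c x \<in> X \<longleftrightarrow> ev (canon g) val_const True (e(x := val_const c)) B) \<and>
        (Neg (subst B c x) \<in> X \<longleftrightarrow> ev (canon g) val_const False (e(x := val_const c)) B)"
      if "c \<in> Consts T" for c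
      using less.IH[of "subst B c x" e] Sent_subst(3)[of x B T c] less.prems that
      unfolding Exists ev_subst by simp
    then show ?thesis
      using less.prems Exists_mem[of x B] NExists_mem[of x B]
      unfolding Exists by (simp add: canon_def)
  qed
qed

lemma tuples_val_const:
  assumes "as \<in> tuples (val_const ` Consts T) n"
  obtains cs where "as = map val_const cs" "set cs \<subseteq> Consts T" "length cs = n"
proof -
  have "as \<in> lists (val_const ` Consts T)" using assms by (auto simp: tuples_def)
  then obtain cs where "as = map val_const cs" "cs \<in> lists (Consts T)"
    unfolding lists_image by blast
  then show ?thesis using that[of cs] assms by (auto simp: tuples_def)
qed

lemma canon_is_struct:
  assumes g: "sig_hom g S T"
  shows "is_struct L S (canon g)"
proof -
  have g': "g ` Consts S \<subseteq> Consts T" and S: "Preds S = Preds T" "arity S = arity T" "ident S = ident T"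
    using g by (auto simp: sig_hom_def)
  have Dom: "Dom (canon g) = val_const ` Consts T" by (simp add: canon_def)
  have sub: "{map val_const cs | cs. lit b P (map Const cs) \<in> X}
      \<subseteq> tuples (val_const ` Consts T) (arity T P)" for b P
    using sent lit_Sent by (fastforce simp: tuples_def)
  have "Consts T \<noteq> {}" using sig by (auto simp: is_signature_def)
  moreover have "pos (canon g) (ident S) = {[a, a] | a. a \<in> Dom (canon g)}"
  proof (intro equalityI subsetI)
    fix as assume "as \<in> pos (canon g) (ident S)"
    then obtain cs where cs: "as = map val_const cs" "lit True (ident T) (map Const cs) \<in> X"
      by (auto simp: canon_def S)
    have "lit True (ident T) (map Const cs) \<in> Sent T" using cs(2) sent by blast
    then have "length cs = 2" using sig by (simp add: lit_Sent is_signature_def)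
    then obtain c d where cd: "cs = [c, d]" by (auto simp: numeral_2_eq_2 length_Suc_conv)
    then have "Eq T c d \<in> X" using cs(2) by (simp add: lit_def)
    then show "as \<in> {[a, a] | a. a \<in> Dom (canon g)}"
      using Eq_consts[of c d] val_const_eq[of c d] cs(1) cd by (auto simp: Dom)
  next
    fix as assume "as \<in> {[a, a] | a. a \<in> Dom (canon g)}"
    then obtain c where c: "c \<in> Consts T" "as = map val_const [c, c]" by (auto simp: Dom)
    then have "lit True (ident T) (map Const [c, c]) \<in> X"
      using Eq_refl by (simp add: lit_def)
    then have "as \<in> {map val_const cs | cs. lit True (ident T) (map Const cs) \<in> X}"
      unfolding c(2) by blast
    then show "as \<in> pos (canon g) (ident S)" by (simp add: canon_def S)
  qed
  moreover have "pos (canon g) P \<union> neg (canon g) P \<subseteq> tuples (Dom (canon g)) (arity S P)" for P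
    using sub by (simp add: canon_def S)
  moreover have "cint (canon g) c \<in> Dom (canon g)" if "c \<in> Consts S" for c
    using g' that by (auto simp: canon_def)
  ultimately have Q: "is_QFDE_struct S (canon g)" by (simp add: is_QFDE_struct_def Dom)
  have E1: "E1 S (canon g)" if "has_PEM L"
    unfolding E1_def
  proof (intro ballI equalityI)
    fix P assume P: "P \<in> Preds S"
    then show "pos (canon g) P \<union> neg (canon g) P \<subseteq> tuples (Dom (canon g)) (arity S P)"
      using Q by (simp add: is_QFDE_struct_def)
    show "tuples (Dom (canon g)) (arity S P) \<subseteq> pos (canon g) P \<union> neg (canon g) P"
    proof
      fix as assume "as \<in> tuples (Dom (canon g)) (arity S P)"
      then obtain cs where cs: "as = map val_const cs" "set cs \<subseteq> Consts T" "length cs = arity T P"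
        unfolding Dom S by (rule tuples_val_const)
      let ?A = "Atom P (map Const cs)"
      have "?A \<in> Sent T" using lit_Sent[of True P cs] P cs by (simp add: lit_def S)
      then have "Dis ?A (Neg ?A) \<in> X" using that by (intro closed derivable_PEM)
      then have "lit True P (map Const cs) \<in> X \<or> lit False P (map Const cs) \<in> X"
        using prime by (simp add: lit_def)
      then show "as \<in> pos (canon g) P \<union> neg (canon g) P"
        unfolding cs(1) by (auto simp: canon_def)
    qed
  qed
  have E2: "E2 S (canon g)" if "has_EXP L"
    unfolding E2_def
  proof (intro ballI, rule ccontr)
    fix P assume "pos (canon g) P \<inter> neg (canon g) P \<noteq> {}"
    \<comment> \<open>A common element of both extensions may be named by different constants in
      each; \<open>lit_mem\<close> transfers the negative literal to the names used in the positive
      one.\<close>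
    then obtain cs where cs: "lit True P (map Const cs) \<in> X"
      "map val_const cs \<in> {map val_const ds | ds. lit False P (map Const ds) \<in> X}"
      by (auto simp: canon_def)
    have "lit True P (map Const cs) \<in> Sent T" using cs(1) sent by blast
    then have "set cs \<subseteq> Consts T" by (simp add: lit_Sent)
    then have "lit False P (map Const cs) \<in> X" using cs(2) lit_mem by simp
    then have "Atom P (map Const cs) \<in> X" "Neg (Atom P (map Const cs)) \<in> X"
      using cs(1) by (simp_all add: lit_def)
    then have "B \<in> X" if "B \<in> Sent T" for B
      using closed[OF derivable_EXP[OF \<open>has_EXP L\<close> hyp hyp that]] by blast
    then show False using proper sent by blast
  qed
  show ?thesis using Q E1 E2 by (cases L) (simp_all add: has_PEM_def has_EXP_def)
qed

end


section \<open>Counting the Henkin constants\<close>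

text \<open>All Henkin constants are coded by sentences of the original signature: \<open>Con\<close> serves as
  pairing and \<open>cnum\<close> as numerals.\<close>

definition cnum :: "('c, 'p) signature \<Rightarrow> 'c \<Rightarrow> nat \<Rightarrow> ('c, 'p) fm" where
  "cnum S c n = (Neg ^^ n) (Eq S c c)"

primrec enc_tm :: "('c, 'p) signature \<Rightarrow> 'c \<Rightarrow> ('c, 'p) fm tm \<Rightarrow> ('c, 'p) fm" where
  "enc_tm S c (Var x) = Con (cnum S c 0) (cnum S c x)"
| "enc_tm S c (Const F) = Con (cnum S c 1) F"

primrec enc_tms :: "('c, 'p) signature \<Rightarrow> 'c \<Rightarrow> ('c, 'p) fm tm list \<Rightarrow> ('c, 'p) fm" where
  "enc_tms S c [] = cnum S c 0"
| "enc_tms S c (t # ts) = Con (enc_tm S c t) (enc_tms S c ts)"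

text \<open>Constants have already been replaced by their codes. A leading numeral marks the
  constructor, and a predicate letter is recorded by its atom with \<open>c\<close> in every place,
  which makes it part of a sentence of \<open>S\<close>.\<close>

primrec enc_fm :: "('c, 'p) signature \<Rightarrow> 'c \<Rightarrow> (('c, 'p) fm, 'p) fm \<Rightarrow> ('c, 'p) fm" where
  "enc_fm S c (Atom P ts) =
     Con (cnum S c 0) (Con (Atom P (replicate (arity S P) (Const c))) (enc_tms S c ts))"
| "enc_fm S c (Neg F) = Con (cnum S c 1) (enc_fm S c F)"
| "enc_fm S c (Con F G) = Con (cnum S c 2) (Con (enc_fm S c F) (enc_fm S c G))"
| "enc_fm S c (Dis F G) = Con (cnum S c 3) (Con (enc_fm S c F) (enc_fm S c G))"
| "enc_fm S c (Forall x F) = Con (cnum S c 4) (Con (cnum S c x) (enc_fm S c F))"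
| "enc_fm S c (Exists x F) = Con (cnum S c 5) (Con (cnum S c x) (enc_fm S c F))"

primrec enc :: "('c, 'p) signature \<Rightarrow> 'c \<Rightarrow> ('c, 'p) hc \<Rightarrow> ('c, 'p) fm" where
  "enc S c (Old a) = Con (cnum S c 0) (Eq S a a)"
| "enc S c (Wit F) = Con (cnum S c 1) (enc_fm S c (map_fm (enc S c) id F))"

lemma cnum_inject [simp]: "cnum S c m = cnum S c n \<longleftrightarrow> m = n"
proof (induction m arbitrary: n)
  case 0
  then show ?case by (cases n) (auto simp: cnum_def)
next
  case (Suc m)
  then show ?case by (cases n) (auto simp: cnum_def)
qed

lemma cnum_neq_Con [simp]: "cnum S c n \<noteq> Con F G" "Con F G \<noteq> cnum S c n"
  by (cases n; simp add: cnum_def)+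

lemma enc_tm_inject: "enc_tm S c s = enc_tm S c t \<longleftrightarrow> s = t"
  by (cases s; cases t) auto

lemma enc_tms_inject: "enc_tms S c ss = enc_tms S c ts \<longleftrightarrow> ss = ts"
proof (induction ss arbitrary: ts)
  case Nil
  then show ?case by (cases ts) auto
next
  case (Cons s ss)
  then show ?case by (cases ts) (auto simp: enc_tm_inject)
qed

lemma enc_fm_inject: "enc_fm S c F = enc_fm S c G \<longleftrightarrow> F = G"
proof (induction F arbitrary: G)
  case (Atom P ts)
  then show ?case by (cases G) (auto simp: enc_tms_inject)
next
  case (Neg F)
  then show ?case by (cases G) auto
next
  case (Con F1 F2)
  then show ?case by (cases G) auto
next
  case (Dis F1 F2)
  then show ?case by (cases G) auto
next
  case (Forall x F)
  then show ?case by (cases G) auto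
next
  case (Exists x F)
  then show ?case by (cases G) auto
qed

lemma enc_inject: "enc S c k = enc S c l \<Longrightarrow> k = l"
proof (induction k arbitrary: l)
  case (Old a)
  then show ?case by (cases l) auto
next
  case (Wit F)
  \<comment> \<open>The induction hypothesis makes \<open>enc\<close> injective at the constants of
    \<open>F\<close>, which is enough for injectivity of the mapping on \<open>F\<close>.\<close>
  then show ?case
    by (cases l) (auto simp: enc_fm_inject intro: fm.inj_map_strong[rotated -1])
qed

lemma is_form_preds: "is_form S A \<Longrightarrow> preds_fm A \<subseteq> Preds S"
  by (induction A) auto

lemma cnum_Sent:
  assumes "is_signature S" and "c \<in> Consts S"
  shows "cnum S c n \<in> Sent S"
  using assms by (induction n) (auto simp: cnum_def Sent_iff Sent_Eq)

lemma enc_fm_Sent: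
  assumes S: "is_signature S" "c \<in> Consts S"
    and "preds_fm F \<subseteq> Preds S" and "consts_fm F \<subseteq> Sent S"
  shows "enc_fm S c F \<in> Sent S"
  using assms(3,4)
proof (induction F)
  case (Atom P ts)
  have "Atom P (replicate (arity S P) (Const c)) \<in> Sent S"
    using Atom S by (auto simp: Sent_def Form_def)
  moreover have "enc_tms S c ts \<in> Sent S" if "\<Union> (set_tm ` set ts) \<subseteq> Sent S"
    using that
  proof (induction ts)
    case (Cons t ts)
    then show ?case by (cases t) (auto simp: Sent_iff cnum_Sent[OF S])
  qed (simp add: cnum_Sent[OF S])
  ultimately show ?case using Atom by (simp add: Sent_iff cnum_Sent[OF S])
qed (auto simp: Sent_iff cnum_Sent[OF S])

lemma enc_Sent:
  assumes S: "is_signature S" "c \<in> Consts S" and "hconst S k"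
  shows "enc S c k \<in> Sent S"
  using assms(3)
proof induction
  case (1 a)
  then show ?case by (simp add: Sent_iff cnum_Sent[OF S] Sent_Eq[OF S(1)])
next
  case (2 F)
  have "preds_fm F \<subseteq> Preds S"
    using 2 is_form_preds[of _ F] by (fastforce simp: Sent_def Form_def)
  then show ?case
    using 2 by (auto simp: Sent_iff cnum_Sent[OF S] fm.set_map intro!: enc_fm_Sent[OF S])
qed


section \<open>Completeness\<close>

lemma derivable_complete:
  fixes S :: "('c, 'p) signature" and f :: "('c, 'p) fm \<Rightarrow> 'd"
  assumes S: "is_signature S" and G: "\<Gamma> \<subseteq> Sent S" and A: "A \<in> Sent S"
    and f: "inj_on f (Sent S)" and ent: "entails TYPE('d) L S \<Gamma> A"
  shows "derivable L S \<Gamma> A"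
proof (rule ccontr)
  let ?T = "henkin_sig S"
  assume "\<not> derivable L S \<Gamma> A"
  then obtain X where X: "henkin_theory L ?T X" "ren Old ` \<Gamma> \<subseteq> X" "ren Old A \<notin> X"
    using henkin_theory_exists[OF S G A] by metis
  obtain c where c: "c \<in> Consts S" using fresh_const[OF S, of "{}"] by auto
  \<comment> \<open>Henkin constants are coded by sentences of \<open>S\<close>, which
    \<open>f\<close> carries into the prescribed type; here its size matters.\<close>
  have "inj_on (f \<circ> enc S c) (Consts ?T)"
    using f enc_Sent[OF S c] by (auto simp: inj_on_def henkin_sig_def dest: enc_inject)
  then interpret henkin_model L ?T X "f \<circ> enc S c"
    using X(1) by (intro henkin_model.intro henkin_model_axioms.intro)
  let ?M = "canon Old :: ('c, 'p, 'd) struct"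
  have val: "val ?M (emb B) \<longleftrightarrow> ren Old B \<in> X" if "B \<in> Sent S" for B
  proof -
    \<comment> \<open>\<open>canon Old\<close> interprets a letter as its \<open>Old\<close> copy,
      so evaluating \<open>B\<close> amounts to evaluating its translation, to which
      \<open>truth\<close> applies.\<close>
    have "ev ?M (cint ?M) True (\<lambda>_. undefined) B
        = ev ?M val_const True (\<lambda>_. undefined) (ren Old B)"
      by (simp add: ev_ren canon_def)
    then show ?thesis
      using truth[OF Sent_ren[OF sig_hom_Old that], of Old "\<lambda>_. undefined"] by (simp add: val_emb)
  qed
  have "is_struct L S ?M" by (rule canon_is_struct[OF sig_hom_Old])
  then have "val ?M (emb A)" using ent G X(2) val unfolding entails_def by blast
  then show False using val[OF A] X(3) by simp
qed

theorem theorem31: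
  fixes S :: "('c, 'p) signature" and L :: logic
    and \<Gamma> :: "('c, 'p) fm set" and A :: "('c, 'p) fm"
  assumes "L \<in> {QLP, QK3, QCL}"
    and "is_signature S"
    and "\<Gamma> \<union> {A} \<subseteq> Sent S"
  shows "(derivable L S \<Gamma> A \<longrightarrow> entails TYPE('d) L S \<Gamma> A) \<and>
         ((\<exists>f :: ('c, 'p) fm \<Rightarrow> 'd. inj_on f (Sent S)) \<longrightarrow>
            (derivable L S \<Gamma> A \<longleftrightarrow> entails TYPE('d) L S \<Gamma> A))"
proof (intro conjI impI iffI)
  show "entails TYPE('d) L S \<Gamma> A" if "derivable L S \<Gamma> A"
    by (rule derivable_sound[OF assms(2) that])
  then show "entails TYPE('d) L S \<Gamma> A" if "derivable L S \<Gamma> A" using that .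
  assume "\<exists>f :: ('c, 'p) fm \<Rightarrow> 'd. inj_on f (Sent S)"
  then obtain f :: "('c, 'p) fm \<Rightarrow> 'd" where f: "inj_on f (Sent S)" ..
  show "derivable L S \<Gamma> A" if "entails TYPE('d) L S \<Gamma> A"
    using assms(3) by (intro derivable_complete[OF assms(2) _ _ f that]) auto
qed

end
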